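(* Let $G$ be a Polish group admitting a continuous surjective homomorphism onto a non-discrete locally compact Polish group. Then \[ \mathrm{cov}(\mathcal{HM}(G))=\mathrm{cov}(\mathcal{M})\quad\text{and}\quad \mathrm{non}(\mathcal{HM}(G))=\mathrm{non}(\mathcal{M}). \]
   Context: A subset $X$ of a Polish group $G$ is Haar meager if there exist a (non-empty) compact metric space $K$, a continuous function $f:K\to G$ and a Borel set $B\subset G$ containing $X$ such that $f^{-1}(gBh)$ is meager in $K$ for every $g,h\in G$; $\mathcal{HM}(G)$ is the family of Haar meager subsets of $G$ (a proper $\sigma$-ideal). For a $\sigma$-ideal $\mathcal{I}$ on a set $X$: $\mathrm{cov}(\mathcal{I})=\min\{|\mathcal{A}|:\mathcal{A}\subset\mathcal{I},\ \bigcup\mathcal{A}=X\}$ and $\mathrm{non}(\mathcal{I})=\min\{|H|:H\subset X,\ H\notin\mathcal{I}\}$. $\mathcal{M}$ is the $\sigma$-ideal of meager subsets of $\mathbb{R}$. *)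

theory Defs
  imports "HOL-Analysis.Analysis"
begin

unbundle cardinal_syntax

section \<open>Meager and Haar meager sets\<close>

definition nowhere_dense_in :: "'a topology \<Rightarrow> 'a set \<Rightarrow> bool" where
  "nowhere_dense_in T S \<longleftrightarrow> S \<subseteq> topspace T \<and> T interior_of (T closure_of S) = {}"

definition meager_in :: "'a topology \<Rightarrow> 'a set \<Rightarrow> bool" where
  "meager_in T S \<longleftrightarrow> (\<exists>\<N>. countable \<N> \<and> (\<forall>A\<in>\<N>. nowhere_dense_in T A) \<and> S = \<Union>\<N>)"

text \<open>
  Polish groups are types of sort \<open>{topological_group_add, polish_space}\<close>; they are written
  additively, but \<^class>\<open>topological_group_add\<close> does not assume commutativity, so the two-sided
  translate $gBh$ is \<open>(\<lambda>b. g + b + h) ` B\<close>.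

  The compact metric space $K$ is existentially quantified, so its points have to come from a fixed
  type. A compact metric space has at most continuum many points, so \<^typ>\<open>real\<close> (as a bare
  set of points; the topology of \<open>K\<close> is arbitrary) suffices; lemma \<open>haar_meagerI\<close> below shows
  that witnesses \<open>K\<close> over any other type give nothing new.
\<close>

definition haar_meager :: "'a::{topological_group_add, polish_space} set \<Rightarrow> bool" where
  "haar_meager X \<longleftrightarrow>
     (\<exists>(K :: real topology) f B.
        topspace K \<noteq> {} \<and> compact_space K \<and> metrizable_space K \<and>
        continuous_map K euclidean f \<and> B \<in> sets borel \<and> X \<subseteq> B \<and>
        (\<forall>g h. meager_in K {x \<in> topspace K. f x \<in> (\<lambda>b. g + b + h) ` B}))"

definition HM :: "'a::{topological_group_add, polish_space} set set" where
  "HM = {X. haar_meager X}"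

definition meager_reals :: "real set set" where
  "meager_reals = {X. meager_in euclidean X}"


section \<open>Cardinal invariants of ideals\<close>

text \<open>
  Cardinals are represented, as in the library, by cardinal orders up to \<open>=o\<close>.
\<close>

definition min_card :: "'a rel set \<Rightarrow> 'a rel" where
  "min_card R = (SOME r. r \<in> R \<and> (\<forall>r'\<in>R. r \<le>o r'))"

definition cov :: "'a set \<Rightarrow> 'a set set \<Rightarrow> 'a set rel" where
  "cov X \<I> = min_card {|\<A>| | \<A>. \<A> \<subseteq> \<I> \<and> \<Union>\<A> = X}"

definition non :: "'a set \<Rightarrow> 'a set set \<Rightarrow> 'a rel" where
  "non X \<I> = min_card {|H| | H. H \<subseteq> X \<and> H \<notin> \<I>}"

lemma min_card:
  assumes "R \<noteq> {}" "\<And>r. r \<in> R \<Longrightarrow> Card_order r"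
  shows "min_card R \<in> R" "r' \<in> R \<Longrightarrow> min_card R \<le>o r'"
proof -
  have "\<exists>r. r \<in> R \<and> (\<forall>r'\<in>R. r \<le>o r')"
    using exists_minim_Card_order[of R] assms by blast
  from someI_ex[OF this] show "min_card R \<in> R" "r' \<in> R \<Longrightarrow> min_card R \<le>o r'"
    unfolding min_card_def by blast+
qed


section \<open>Independence of the type carrying the compact space\<close>

lemma compact_metrizable_lepoll_real:
  assumes "compact_space K" "metrizable_space K"
  shows "topspace K \<lesssim> (UNIV :: real set)"
proof -
  obtain M d where M: "Metric_space M d" and K: "K = Metric_space.mtopology M d"
    using assms(2) unfolding metrizable_space_def by blast
  interpret Metric_space M d by (rule M)
  have tb: "mtotally_bounded M"
    using assms(1) K compactin_imp_mtotally_bounded compact_space_def by force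
  define P where "P n F \<longleftrightarrow> finite F \<and> F \<subseteq> M \<and> M \<subseteq> (\<Union>x\<in>F. mball x (1 / real (Suc n)))" for n F
  have "\<exists>F. P n F" for n
    using tb unfolding mtotally_bounded_def P_def by force
  then obtain F where F: "P n (F n)" for n
    by metis
  define \<B> where "\<B> = (\<Union>n. (\<lambda>x. mball x (1 / real (Suc n))) ` F n)"
  have "finite (F n)" for n
    using F[of n] by (simp add: P_def)
  then have cB: "countable \<B>"
    unfolding \<B>_def by (simp add: countable_finite)
  have sep: "\<exists>b\<in>\<B>. x \<in> b \<and> y \<notin> b" if xy: "x \<in> M" "y \<in> M" "x \<noteq> y" for x y
  proof -
    have "0 < d x y" using xy by (simp add: mdist_pos_less)
    then obtain n where "1 / real (Suc n) < d x y / 2"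
      using nat_approx_posE[of "d x y / 2"] by auto
    then have n: "1 / real (Suc n) + 1 / real (Suc n) < d x y"
      by linarith
    obtain z where z: "z \<in> F n" "x \<in> mball z (1 / real (Suc n))"
      using F[of n] xy unfolding P_def by blast
    have "y \<notin> mball z (1 / real (Suc n))"
    proof
      assume "y \<in> mball z (1 / real (Suc n))"
      then have "d z y < 1 / real (Suc n)" "d z x < 1 / real (Suc n)" "z \<in> M" using z by auto
      moreover have "d x y \<le> d z x + d z y"
        using triangle[of x z y] xy \<open>z \<in> M\<close> by (simp add: commute[of x z])
      ultimately show False using n by linarith
    qed
    then show ?thesis using z unfolding \<B>_def by blast
  qed
  define e where "e x = {n. x \<in> from_nat_into \<B> n}" for x
  have "inj_on e M"
  proof (rule inj_onI, rule ccontr)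
    fix x y assume xy: "x \<in> M" "y \<in> M" "e x = e y" "x \<noteq> y"
    then obtain b where "b \<in> \<B>" "x \<in> b" "y \<notin> b" using sep by blast
    moreover then obtain n where "from_nat_into \<B> n = b"
      using cB from_nat_into_surj by metis
    ultimately show False using xy(3) unfolding e_def by blast
  qed
  then have "M \<lesssim> (UNIV :: nat set set)"
    unfolding lepoll_def by blast
  then show ?thesis
    using K lepoll_trans2[OF _ nat_sets_eqpoll_reals] by simp
qed

lemma meager_in_homeomorphic_image:
  assumes h: "homeomorphic_map T T' h" and S: "meager_in T S"
  shows "meager_in T' (h ` S)"
proof -
  obtain \<N> where N: "countable \<N>" "\<And>A. A \<in> \<N> \<Longrightarrow> nowhere_dense_in T A" "S = \<Union>\<N>"
    using S unfolding meager_in_def by blast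
  have "nowhere_dense_in T' (h ` A)" if "nowhere_dense_in T A" for A
  proof -
    have A: "A \<subseteq> topspace T" "T interior_of (T closure_of A) = {}"
      using that by (auto simp: nowhere_dense_in_def)
    then have "T' interior_of (T' closure_of (h ` A)) = {}"
      by (simp add: homeomorphic_map_closure_of[OF h] homeomorphic_map_interior_of[OF h]
          closure_of_subset_topspace)
    moreover have "h ` A \<subseteq> topspace T'"
      using A h homeomorphic_imp_surjective_map by blast
    ultimately show ?thesis by (simp add: nowhere_dense_in_def)
  qed
  then have "\<forall>A\<in>(`) h ` \<N>. nowhere_dense_in T' A"
    using N(2) by blast
  moreover have "countable ((`) h ` \<N>)"
    using N(1) by simp
  moreover have "h ` S = \<Union>((`) h ` \<N>)"
    by (simp only: N(3) image_Union)
  ultimately show ?thesis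
    unfolding meager_in_def by (intro exI[of _ "(`) h ` \<N>"] conjI)
qed

lemma haar_meagerI:
  fixes K :: "'k topology" and X :: "'a::{topological_group_add, polish_space} set"
  assumes K: "topspace K \<noteq> {}" "compact_space K" "metrizable_space K"
    and f: "continuous_map K euclidean f"
    and B: "B \<in> sets borel" "X \<subseteq> B"
    and meager: "\<And>g h. meager_in K {x \<in> topspace K. f x \<in> (\<lambda>b. g + b + h) ` B}"
  shows "haar_meager X"
proof -
  obtain e :: "'k \<Rightarrow> real" where e: "inj_on e (topspace K)"
    using compact_metrizable_lepoll_real[OF K(2,3)] unfolding lepoll_def by blast
  define e' where "e' = inv_into (topspace K) e"
  define K' where "K' = pullback_topology (e ` topspace K) e' K"
  have e'e: "e' (e x) = x" if "x \<in> topspace K" for x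
    using that e by (simp add: e'_def)
  have top: "topspace K' = e ` topspace K"
    using e'e by (auto simp: K'_def topspace_pullback_topology)
  have "continuous_map K K' e"
    unfolding continuous_map_def
  proof (intro conjI allI impI)
    show "e \<in> topspace K \<rightarrow> topspace K'" by (auto simp: top)
  next
    fix U assume "openin K' U"
    then obtain V where V: "openin K V" "U = e' -` V \<inter> e ` topspace K"
      by (auto simp: K'_def openin_pullback_topology)
    have "e x \<in> U \<longleftrightarrow> x \<in> V" if "x \<in> topspace K" for x
      using that by (simp add: V(2) e'e)
    then have "{x \<in> topspace K. e x \<in> U} = V"
      using openin_subset[OF V(1)] by blast
    with V show "openin K {x \<in> topspace K. e x \<in> U}" by simp
  qed
  moreover have c': "continuous_map K' K e'"
    unfolding continuous_map_def
  proof (intro conjI allI impI)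
    show "e' \<in> topspace K' \<rightarrow> topspace K" by (auto simp: top e'e)
  next
    fix U assume U: "openin K U"
    have "{x \<in> topspace K'. e' x \<in> U} = e' -` U \<inter> e ` topspace K" by (auto simp: top)
    with U show "openin K' {x \<in> topspace K'. e' x \<in> U}"
      by (auto simp: K'_def openin_pullback_topology)
  qed
  ultimately have "homeomorphic_maps K K' e e'"
    by (auto simp: homeomorphic_maps_def top e'e)
  then have h: "homeomorphic_map K K' e"
    by (simp add: homeomorphic_maps_map)
  then have hs: "K homeomorphic_space K'"
    using homeomorphic_map_imp_homeomorphic_space by blast
  have eq: "{y \<in> topspace K'. (f \<circ> e') y \<in> C} = e ` {x \<in> topspace K. f x \<in> C}" for C
    by (auto simp: top e'e)
  show ?thesis
    unfolding haar_meager_def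
  proof (intro exI conjI allI)
    show "topspace K' \<noteq> {}" using K(1) top by simp
    show "compact_space K'" using K(2) hs homeomorphic_compact_space by blast
    show "metrizable_space K'" using K(3) hs homeomorphic_metrizable_space by blast
    show "continuous_map K' euclidean (f \<circ> e')" using c' f continuous_map_compose by blast
    show "B \<in> sets borel" "X \<subseteq> B" by (fact B)+
    show "meager_in K' {x \<in> topspace K'. (f \<circ> e') x \<in> (\<lambda>b. g + b + h) ` B}" for g h
      unfolding eq by (rule meager_in_homeomorphic_image[OF h meager])
  qed
qed

end

theory Submission
  imports Defs
begin

text \<open>
  Both equalities come from two functions: \<open>\<alpha>\<close> from the reals to the group \<open>G\<close> along which Haar
  meager sets pull back to meager sets, and \<open>\<beta>\<close> from \<open>G\<close> to the reals along which meager sets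
  pull back to Haar meager sets. Pulling back covers compares the covering numbers, and taking
  images of sets outside the ideal compares the uniformities, in both directions.

  For \<open>\<alpha>\<close>, every Haar meager set is meager (\<open>haar_meager_imp_meager\<close>): a Borel set is open
  modulo a meager set \<open>M\<close>. A generic translate of \<open>M\<close> has meager preimage in the witnessing
  compact space, so for a Haar meager set the open part must be empty, as otherwise some of its
  preimages would contradict the Baire category theorem there.
  It remains to find a function from the reals to \<open>G\<close> that pulls back meager sets to meager sets.
  Such a function exists from any second countable metric space without isolated points to
  any Polish space (\<open>ex_meager_preserving_vimage\<close>): it is defined on a comeager set by matching a
  tree of open sets in the domain with one in the codomain.

  For \<open>\<beta>\<close>, compose the homomorphism \<open>\<phi>\<close> onto the locally compact group \<open>H\<close> with such a function from \<open>H\<close>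
  to the reals; \<open>H\<close> has no isolated points because it is not discrete. What is needed is that the
  preimage under \<open>\<phi>\<close> of a meager set is Haar meager (\<open>haar_meager_vimage_meager\<close>). In a locally
  compact group a compact neighbourhood witnesses that a meager set is Haar meager, and the task is
  to lift this witness to \<open>G\<close>. The homomorphism is open (\<open>open_image_homomorphism\<close>), so the image of
  some compact subset of \<open>G\<close> covers a compact neighbourhood; shrinking it to a minimal one makes the
  images of its relatively open subsets somewhere dense, so that nowhere dense sets of \<open>H\<close> have nowhere
  dense preimages in it.
\<close>

section \<open>Meager sets\<close>

text \<open>
  Closures of nowhere dense sets are nowhere dense, so meager sets may be handled through covers
  by closed sets with empty interior; preimages of such covers under continuous maps are again
  closed, and only their interiors have to be controlled.
\<close>

lemma meager_in_iff_subset_closed: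
  "meager_in T S \<longleftrightarrow> S \<subseteq> topspace T \<and>
     (\<exists>\<F>. countable \<F> \<and> (\<forall>F\<in>\<F>. closedin T F \<and> T interior_of F = {}) \<and> S \<subseteq> \<Union>\<F>)"
proof safe
  assume "meager_in T S"
  then obtain \<N> where N: "countable \<N>" "\<And>A. A \<in> \<N> \<Longrightarrow> nowhere_dense_in T A" "S = \<Union>\<N>"
    unfolding meager_in_def by blast
  show "x \<in> topspace T" if "x \<in> S" for x
    using N that by (auto simp: nowhere_dense_in_def)
  show "\<exists>\<F>. countable \<F> \<and> (\<forall>F\<in>\<F>. closedin T F \<and> T interior_of F = {}) \<and> S \<subseteq> \<Union>\<F>"
  proof (intro exI conjI)
    show "countable ((closure_of) T ` \<N>)" using N(1) by simp
    show "\<forall>F\<in>(closure_of) T ` \<N>. closedin T F \<and> T interior_of F = {}"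
      using N(2) by (auto simp: nowhere_dense_in_def)
    have "A \<subseteq> T closure_of A" if "A \<in> \<N>" for A
      using N(2)[OF that] by (simp add: nowhere_dense_in_def closure_of_subset)
    then show "S \<subseteq> \<Union>((closure_of) T ` \<N>)"
      unfolding N(3) by blast
  qed
next
  fix \<F> assume S: "S \<subseteq> topspace T" and F: "countable \<F>"
    "\<forall>F\<in>\<F>. closedin T F \<and> T interior_of F = {}" "S \<subseteq> \<Union>\<F>"
  have "nowhere_dense_in T (F \<inter> S)" if "F \<in> \<F>" for F
  proof -
    have "T closure_of (F \<inter> S) \<subseteq> F"
      using F(2) that by (simp add: closure_of_minimal)
    then have "T interior_of (T closure_of (F \<inter> S)) \<subseteq> T interior_of F"
      by (rule interior_of_mono)
    then show ?thesis
      using F(2) that S by (auto simp: nowhere_dense_in_def)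
  qed
  moreover have "S = \<Union>((\<lambda>F. F \<inter> S) ` \<F>)"
    using F(3) by blast
  ultimately show "meager_in T S"
    unfolding meager_in_def using F(1)
    by (intro exI[of _ "(\<lambda>F. F \<inter> S) ` \<F>"]) auto
qed

lemma meager_in_subset: "meager_in T S \<Longrightarrow> S' \<subseteq> S \<Longrightarrow> meager_in T S'"
  unfolding meager_in_iff_subset_closed by (meson order_trans)

lemma meager_in_Union:
  assumes "countable \<A>" "\<And>A. A \<in> \<A> \<Longrightarrow> meager_in T A"
  shows "meager_in T (\<Union>\<A>)"
proof -
  obtain \<F> where F: "countable (\<F> A)" "\<forall>F\<in>\<F> A. closedin T F \<and> T interior_of F = {}" "A \<subseteq> \<Union>(\<F> A)"
    if "A \<in> \<A>" for A
    using assms(2) unfolding meager_in_iff_subset_closed by metis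
  show ?thesis
    unfolding meager_in_iff_subset_closed
  proof (intro conjI exI)
    show "\<Union>\<A> \<subseteq> topspace T"
      using assms(2) unfolding meager_in_iff_subset_closed by blast
    show "countable (\<Union>(\<F> ` \<A>))" using assms(1) F(1) by auto
    show "\<forall>F\<in>\<Union>(\<F> ` \<A>). closedin T F \<and> T interior_of F = {}" using F(2) by blast
    show "\<Union>\<A> \<subseteq> \<Union>(\<Union>(\<F> ` \<A>))" using F(3) by blast
  qed
qed

lemma meager_in_Un: "meager_in T A \<Longrightarrow> meager_in T B \<Longrightarrow> meager_in T (A \<union> B)"
  using meager_in_Union[of "{A, B}" T] by auto

lemma meager_in_closed: "closedin T F \<Longrightarrow> T interior_of F = {} \<Longrightarrow> meager_in T F"
  unfolding meager_in_iff_subset_closed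
  by (intro conjI exI[of _ "{F}"]) (auto dest: closedin_subset)

lemma meager_euclidean_iff:
  "meager_in euclidean S \<longleftrightarrow>
     (\<exists>\<F>. countable \<F> \<and> (\<forall>F\<in>\<F>. closed F \<and> interior F = {}) \<and> S \<subseteq> \<Union>\<F>)"
  by (simp add: meager_in_iff_subset_closed)

lemma meager_closed: "closed F \<Longrightarrow> interior F = {} \<Longrightarrow> meager_in euclidean F"
  by (rule meager_in_closed) auto

lemma Baire_open_meager_empty:
  assumes "completely_metrizable_space T" "openin T U" "meager_in T U"
  shows "U = {}"
proof -
  obtain \<F> where F: "countable \<F>" "\<forall>F\<in>\<F>. closedin T F \<and> T interior_of F = {}" "U \<subseteq> \<Union>\<F>"
    using assms(3) unfolding meager_in_iff_subset_closed by blast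
  have "T interior_of \<Union>\<F> = {}"
    using Baire_category_alt[of T \<F>] assms(1) F by blast
  then show ?thesis
    using interior_of_maximal[OF F(3) assms(2)] by simp
qed

lemma open_meager_empty:
  fixes U :: "'a::complete_space set"
  assumes "open U" "meager_in euclidean U"
  shows "U = {}"
  using assms Baire_open_meager_empty[OF completely_metrizable_space_euclidean, of U] by simp

lemma meager_homeomorphism:
  fixes h k :: "'a::topological_space \<Rightarrow> 'a"
  assumes "continuous_on UNIV h" "continuous_on UNIV k" "\<And>x. k (h x) = x" "\<And>x. h (k x) = x"
    "meager_in euclidean S"
  shows "meager_in euclidean (h ` S)"
proof (rule meager_in_homeomorphic_image)
  have "homeomorphic_maps euclidean euclidean h k"
    using assms by (simp add: homeomorphic_maps_def)
  then show "homeomorphic_map euclidean euclidean h"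
    by (simp add: homeomorphic_maps_map)
qed (use assms in simp)

text \<open>
  This is the Baire property. Sets equal to an open set up to a meager set form a
  \<open>\<sigma>\<close>-algebra, because the boundary of an open set is nowhere dense.
\<close>

lemma open_meager_difference_of_borel:
  fixes B :: "'a::topological_space set"
  assumes "B \<in> sets borel"
  shows "\<exists>U. open U \<and> meager_in euclidean (B - U) \<and> meager_in euclidean (U - B)"
proof -
  define P :: "'a set \<Rightarrow> bool" where
    "P B \<longleftrightarrow> (\<exists>U. open U \<and> meager_in euclidean (B - U) \<and> meager_in euclidean (U - B))" for B
  have "B \<in> sigma_sets UNIV {S. open S}"
    using assms by (simp add: borel_def)
  then have "P B"
  proof (induction rule: sigma_sets.induct)
    case (Basic S)
    have "meager_in (euclidean :: 'a topology) {}"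
      by (rule meager_closed) auto
    with Basic show ?case unfolding P_def by (intro exI[of _ S]) auto
  next
    case Empty
    have "meager_in (euclidean :: 'a topology) {}"
      by (rule meager_closed) auto
    then show ?case unfolding P_def by (intro exI[of _ "{}"]) auto
  next
    case (Compl S)
    then obtain U where U: "open U" "meager_in euclidean (S - U)" "meager_in euclidean (U - S)"
      unfolding P_def by blast
    \<comment> \<open>The complement of \<open>U\<close> differs from its interior by the boundary of \<open>U\<close>.\<close>
    have fr: "meager_in euclidean (closure U - U)"
    proof (rule meager_closed)
      show "closed (closure U - U)" using U(1) by (simp add: closed_Diff)
      have "I = {}" if I: "open I" "I \<subseteq> closure U - U" for I
      proof -
        have "I \<inter> U = {}" using I by blast
        then have "I \<inter> closure U = {}" using I(1) open_Int_closure_eq_empty by blast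
        then show ?thesis using I by blast
      qed
      from this[OF open_interior interior_subset] show "interior (closure U - U) = {}" .
    qed
    have "meager_in euclidean ((UNIV - S) - (- closure U))"
      by (rule meager_in_subset[OF meager_in_Un[OF fr U(3)]]) blast
    moreover have "meager_in euclidean (- closure U - (UNIV - S))"
      by (rule meager_in_subset[OF U(2)]) (use closure_subset[of U] in blast)
    ultimately show ?case unfolding P_def by (intro exI[of _ "- closure U"]) auto
  next
    case (Union S)
    then obtain U where U: "open (U i)" "meager_in euclidean (S i - U i)"
        "meager_in euclidean (U i - S i)" for i :: nat
      unfolding P_def by metis
    have "meager_in euclidean (\<Union>i. S i - U i)" "meager_in euclidean (\<Union>i. U i - S i)"
      by (rule meager_in_Union; use U in auto)+
    then have "meager_in euclidean ((\<Union>i. S i) - (\<Union>i. U i))"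
      "meager_in euclidean ((\<Union>i. U i) - (\<Union>i. S i))"
      by (blast intro: meager_in_subset)+
    then show ?case unfolding P_def using U(1) by (intro exI[of _ "\<Union>i. U i"]) auto
  qed
  then show ?thesis unfolding P_def .
qed

section \<open>Haar meager sets are meager\<close>

lemma compact_metrizable_imp_separable:
  assumes "compact_space K" "metrizable_space K"
  shows "separable_space K"
proof -
  obtain M d where M: "Metric_space M d" and K: "K = Metric_space.mtopology M d"
    using assms(2) unfolding metrizable_space_def by blast
  interpret Metric_space M d by (rule M)
  have "mtotally_bounded M"
    using assms(1) K compactin_imp_mtotally_bounded compact_space_def by force
  then have "\<exists>F. finite F \<and> F \<subseteq> M \<and> M \<subseteq> (\<Union>x\<in>F. mball x (1 / real (Suc n)))" for n
    unfolding mtotally_bounded_def by force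
  then obtain F where F: "finite (F n)" "F n \<subseteq> M" "M \<subseteq> (\<Union>x\<in>F n. mball x (1 / real (Suc n)))" for n
    by metis
  have "M \<subseteq> mtopology closure_of (\<Union>n. F n)"
  proof
    fix x assume x: "x \<in> M"
    show "x \<in> mtopology closure_of (\<Union>n. F n)"
      unfolding metric_closure_of
    proof (intro CollectI conjI allI impI x)
      fix r :: real assume "0 < r"
      then obtain n where n: "1 / real (Suc n) < r"
        using nat_approx_posE by blast
      obtain z where "z \<in> F n" "x \<in> mball z (1 / real (Suc n))"
        using F(3) x by blast
      then show "\<exists>y\<in>\<Union>n. F n. y \<in> mball x r"
        using n by (intro bexI[of _ z]) (auto simp: commute)
    qed
  qed
  moreover have "mtopology closure_of (\<Union>n. F n) \<subseteq> M"
    by (metis closure_of_subset_topspace topspace_mtopology)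
  ultimately show ?thesis
    unfolding separable_space_def K topspace_mtopology using F(1)
    by (intro exI[of _ "\<Union>n. F n"] conjI UN_least F(2) equalityI countable_UN)
       (auto simp: countable_finite)
qed

lemma compact_metrizable_imp_completely_metrizable:
  assumes "compact_space K" "metrizable_space K"
  shows "completely_metrizable_space K"
  using assms unfolding metrizable_space_def completely_metrizable_space_def
  using Metric_space.compact_space_imp_mcomplete by metis

text \<open>
  Suppose a Haar meager Borel set \<open>B\<close>, with witness \<open>f\<close> on \<open>K\<close>, were not meager. By the Baire
  property \<open>B\<close> contains a nonempty open set \<open>U\<close> up to a union \<open>M\<close> of closed nowhere dense
  sets. A countable dense set \<open>D\<close> of \<open>K\<close> is mapped into \<open>g + M\<close>
  only for meagerly many \<open>g\<close>; for all other \<open>g\<close> the preimage of \<open>g + M\<close> is meager, being a countable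
  union of closed sets missing a dense set. Some such \<open>g\<close> also makes the preimage of \<open>g + U\<close>
  nonempty, and this is an open subset of \<open>K\<close> covered by two meager sets.
\<close>

lemma haar_meager_imp_meager:
  fixes X :: "'a::{topological_group_add, polish_space} set"
  assumes "haar_meager X"
  shows "meager_in euclidean X"
proof (rule ccontr)
  assume nm: "\<not> meager_in euclidean X"
  obtain K :: "real topology" and f B where K: "topspace K \<noteq> {}" "compact_space K" "metrizable_space K"
    and f: "continuous_map K euclidean f"
    and B: "B \<in> sets borel" "X \<subseteq> B"
    and m: "\<And>g h. meager_in K {x \<in> topspace K. f x \<in> (\<lambda>b. g + b + h) ` B}"
    using assms unfolding haar_meager_def by auto
  obtain U where U: "open U" "meager_in euclidean (B - U)" "meager_in euclidean (U - B)"
    using open_meager_difference_of_borel[OF B(1)] by blast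
  have "U \<noteq> {}"
    using U(2) nm B(2) meager_in_subset by fastforce
  then obtain u where u: "u \<in> U" by blast
  obtain \<F> where F: "countable \<F>" "\<forall>F\<in>\<F>. closed F \<and> interior F = {}" "U - B \<subseteq> \<Union>\<F>"
    using U(3) unfolding meager_euclidean_iff by blast
  obtain D where D: "countable D" "D \<subseteq> topspace K" "K closure_of D = topspace K"
    using compact_metrizable_imp_separable[OF K(2,3)] unfolding separable_space_def by blast
  define bad where "bad = (\<Union>(d, F)\<in>D \<times> \<F>. (\<lambda>y. f d - y) ` F)"
  have "meager_in euclidean ((\<lambda>y. f d - y) ` F)" if "F \<in> \<F>" for d F
    using that F(2)
    by (intro meager_homeomorphism[where k = "\<lambda>y. - y + f d"] meager_closed continuous_intros)
       (auto simp: diff_add_eq_diff_diff_swap)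
  then have bad: "meager_in euclidean bad"
    unfolding bad_def using D(1) F(1) by (intro meager_in_Union) auto
  obtain k where k: "k \<in> topspace K" using K(1) by blast
  define W where "W = (\<lambda>g. - g + f k) -` U"
  have "open W" unfolding W_def by (intro open_vimage U(1) continuous_intros)
  moreover have "f k - u \<in> W" using u by (simp add: W_def)
  ultimately have "\<not> W \<subseteq> bad"
    using open_meager_empty meager_in_subset[OF bad] by blast
  then obtain g where g: "- g + f k \<in> U" "g \<notin> bad" unfolding W_def by blast
  define pre where "pre S = {x \<in> topspace K. - g + f x \<in> S}" for S
  have c: "continuous_map K euclidean (\<lambda>x. - g + f x)"
    using continuous_map_compose[OF f, of euclidean "\<lambda>y. - g + y"]
    by (simp add: comp_def continuous_intros)
  have "meager_in K (pre F)" if "F \<in> \<F>" for F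
  proof (rule meager_in_closed)
    show "closedin K (pre F)"
      unfolding pre_def using F(2) that by (intro closedin_continuous_map_preimage[OF c]) auto
    have "D \<inter> pre F = {}"
    proof -
      have "g \<in> (\<lambda>y. f d - y) ` F" if "- g + f d \<in> F" for d
        using that by (intro image_eqI[of _ _ "- g + f d"]) (auto simp: diff_add_eq_diff_diff_swap)
      then show ?thesis using g(2) that unfolding bad_def pre_def by blast
    qed
    then have "D \<inter> (K interior_of pre F) = {}"
      using interior_of_subset by fastforce
    then have "K closure_of D \<inter> (K interior_of pre F) = {}"
      by (metis inf_commute openin_Int_closure_of_eq_empty openin_interior_of)
    then show "K interior_of pre F = {}"
      using D(3) interior_of_subset_topspace by fastforce
  qed
  then have "meager_in K (\<Union>F\<in>\<F>. pre F)"
    using F(1) by (intro meager_in_Union) auto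
  moreover have "meager_in K (pre B)"
  proof -
    have "f x \<in> (\<lambda>b. g + b + 0) ` B \<longleftrightarrow> - g + f x \<in> B" for x
      by (auto intro!: image_eqI[of _ _ "- g + f x"])
    then show ?thesis using m[of g 0] by (simp add: pre_def)
  qed
  ultimately have "meager_in K (pre U)"
    by (rule meager_in_subset[OF meager_in_Un]) (use F(3) in \<open>auto simp: pre_def\<close>)
  moreover have "openin K (pre U)"
    unfolding pre_def using U(1) by (intro openin_continuous_map_preimage[OF c]) auto
  ultimately have "pre U = {}"
    using Baire_open_meager_empty compact_metrizable_imp_completely_metrizable[OF K(2,3)] by blast
  then show False using g(1) k unfolding pre_def by blast
qed

section \<open>Continuous surjective homomorphisms of Polish groups are open\<close>

lemma open_translation_group:
  fixes S :: "'a::topological_group_add set"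
  assumes "open S"
  shows "open ((+) g ` S)"
proof -
  have "(+) g ` S = (\<lambda>x. - g + x) -` S"
    by (auto intro!: image_eqI[of _ _ "- g + x" for x])
  moreover have "open ((\<lambda>x. - g + x) -` S)"
    by (intro open_vimage[OF assms] continuous_intros)
  ultimately show ?thesis by simp
qed

lemma open_square_in_vimage:
  fixes f :: "'a::topological_space \<times> 'a \<Rightarrow> 'b::topological_space"
  assumes "continuous_on UNIV f" "open W" "f (x, x) \<in> W"
  obtains V where "open V" "x \<in> V" "\<And>a b. a \<in> V \<Longrightarrow> b \<in> V \<Longrightarrow> f (a, b) \<in> W"
proof -
  have "open (f -` W)" using assms by (intro open_vimage)
  then obtain A B where AB: "open A" "open B" "(x, x) \<in> A \<times> B" "A \<times> B \<subseteq> f -` W"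
    using assms(3) by (auto elim: open_prod_elim)
  show thesis
  proof (rule that[of "A \<inter> B"])
    show "open (A \<inter> B)" "x \<in> A \<inter> B" using AB by auto
    show "f (a, b) \<in> W" if "a \<in> A \<inter> B" "b \<in> A \<inter> B" for a b
      using AB(4) that by blast
  qed
qed

lemma refine_open_by_basis:
  fixes x :: "'a::metric_space"
  assumes "topological_basis \<B>" "open W" "x \<in> W" "e > 0"
  obtains V where "V \<in> \<B>" "x \<in> V" "closure V \<subseteq> W" "V \<subseteq> ball x e"
proof -
  obtain r where r: "r > 0" "ball x r \<subseteq> W"
    by (rule openE[OF assms(2,3)])
  define s where "s = min r e / 2"
  have s: "s > 0" "s < r" "s < e" using r assms(4) by (auto simp: s_def)
  then have "x \<in> ball x s" by simp
  from topological_basisE[OF assms(1) open_ball this]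
  obtain V where V: "V \<in> \<B>" "x \<in> V" "V \<subseteq> ball x s" .
  have "closure V \<subseteq> cball x s" using V(3) by (intro closure_minimal) auto
  moreover have "cball x s \<subseteq> ball x r" "ball x s \<subseteq> ball x e" using s by auto
  ultimately show thesis using r(2) V by (intro that[of V]) (blast+)
qed

text \<open>
  Cantor's intersection theorem, arranged for sets that are not closed: the closure of each set lies
  in the preceding one, which puts the limit point into all of them.
\<close>

lemma nested_small_sets_limit:
  fixes V :: "nat \<Rightarrow> 'a::complete_space set"
  assumes ne: "\<And>n. V n \<noteq> {}"
    and nest: "\<And>n. closure (V (Suc n)) \<subseteq> V n"
    and small: "\<And>n. \<exists>c. V (Suc n) \<subseteq> ball c (1 / real (Suc n))"
  obtains a where "\<And>n. a \<in> V n" "\<And>U. open U \<Longrightarrow> a \<in> U \<Longrightarrow> \<exists>n. V n \<subseteq> U"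
proof -
  define S where "S n = closure (V (Suc n))" for n
  have sub: "S n \<subseteq> V n" for n using nest unfolding S_def .
  have dec: "S (Suc n) \<subseteq> S n" for n
    using nest[of "Suc n"] closure_subset[of "V (Suc n)"] unfolding S_def by blast
  have close: "dist x y < 2 / real (Suc n) + e" if "x \<in> S n" "y \<in> S n" "e > 0" for x y n e
  proof -
    obtain c where "V (Suc n) \<subseteq> ball c (1 / real (Suc n))" using small by blast
    then have "S n \<subseteq> cball c (1 / real (Suc n))"
      unfolding S_def by (intro closure_minimal) (auto intro: less_imp_le)
    then have "dist c x \<le> 1 / real (Suc n)" "dist c y \<le> 1 / real (Suc n)" using that by auto
    then show ?thesis using dist_triangle3[of x y c] that(3) by auto
  qed
  have small': "\<exists>n. \<forall>x\<in>S n. \<forall>y\<in>S n. dist x y < \<epsilon>" if "\<epsilon> > 0" for \<epsilon> :: real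
  proof -
    obtain n where n: "1 / real (Suc n) < \<epsilon> / 4" using \<open>\<epsilon> > 0\<close> nat_approx_posE[of "\<epsilon> / 4"] by auto
    have "dist x y < \<epsilon>" if "x \<in> S n" "y \<in> S n" for x y
      using close[OF that, of "\<epsilon> / 4"] n \<open>\<epsilon> > 0\<close> by simp
    then show ?thesis by blast
  qed
  obtain a where a: "\<And>n. a \<in> S n"
  proof (rule decreasing_closed_nest)
    show "closed (S n)" for n by (simp add: S_def)
    show "S n \<noteq> {}" for n using ne[of "Suc n"] by (simp add: S_def)
    show "S n \<subseteq> S m" if "m \<le> n" for m n using dec that by (rule lift_Suc_antimono_le)
  qed (use small' in blast)+
  show thesis
  proof (rule that)
    show "a \<in> V n" for n using a sub by blast
    fix U assume "open U" "a \<in> U"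
    then obtain r where r: "r > 0" "ball a r \<subseteq> U" using openE by blast
    obtain n where "\<forall>x\<in>S n. \<forall>y\<in>S n. dist x y < r" using small' r(1) by blast
    then have "S n \<subseteq> ball a r" using a by auto
    then have "V (Suc n) \<subseteq> U" using r(2) closure_subset[of "V (Suc n)"] unfolding S_def by blast
    then show "\<exists>n. V n \<subseteq> U" by blast
  qed
qed

lemma additive_basics:
  fixes \<phi> :: "'g::group_add \<Rightarrow> 'h::group_add"
  assumes "\<And>x y. \<phi> (x + y) = \<phi> x + \<phi> y"
  shows "\<phi> 0 = 0" "\<phi> (- x) = - \<phi> x" "\<phi> (x - y) = \<phi> x - \<phi> y"
proof -
  show 0: "\<phi> 0 = 0" using assms[of 0 0] add_left_cancel[of "\<phi> 0" "\<phi> 0" 0] by simp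
  show m: "\<phi> (- x) = - \<phi> x" for x
    using assms[of "- x" x] 0 by (simp add: eq_neg_iff_add_eq_0)
  show "\<phi> (x - y) = \<phi> x - \<phi> y"
    using assms[of x "- y"] m by simp
qed

context
  fixes \<phi> :: "'g::{topological_group_add, polish_space} \<Rightarrow> 'h::{topological_group_add, polish_space}"
  assumes cont: "continuous_on UNIV \<phi>"
    and surj: "surj \<phi>"
    and add: "\<And>x y. \<phi> (x + y) = \<phi> x + \<phi> y"
begin

lemmas hom = additive_basics[OF add]

text \<open>
  Countably many translates of an open set \<open>V\<close> cover the domain, so the Baire category theorem
  makes the closure of \<open>\<phi> ` V\<close> have interior points; differences move them to \<open>0\<close>.
\<close>

lemma nearly_open:
  assumes "open W" "x \<in> W"
  shows "\<phi> x \<in> interior (closure (\<phi> ` W))"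
proof -
  have "continuous_on UNIV (\<lambda>p :: 'g \<times> 'g. x + (- fst p + snd p))"
    by (intro continuous_intros)
  from open_square_in_vimage[OF this, of W 0] obtain V where V: "open V" "0 \<in> V"
    "\<And>a b. a \<in> V \<Longrightarrow> b \<in> V \<Longrightarrow> x + (- a + b) \<in> W"
    using assms by auto
  obtain \<F> where F: "\<F> \<subseteq> range (\<lambda>g. (+) g ` V)" "countable \<F>" "\<Union>\<F> = \<Union>(range (\<lambda>g. (+) g ` V))"
    using Lindelof[of "range (\<lambda>g. (+) g ` V)"] open_translation_group[OF V(1)] by blast
  have "g \<in> (+) g ` V" for g
    using V(2) by (auto intro!: image_eqI[of _ _ 0])
  then have "g \<in> \<Union>\<F>" for g unfolding F(3) by (intro UnionI[of "(+) g ` V"]) auto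
  then have cov: "\<exists>S\<in>\<F>. g \<in> S" for g by (meson UnionE)
  have "y \<in> (\<Union>S\<in>\<F>. closure (\<phi> ` S))" for y
  proof -
    obtain z where "y = \<phi> z" using surj by blast
    moreover obtain S where "S \<in> \<F>" "z \<in> S" using cov by blast
    moreover have "\<phi> z \<in> closure (\<phi> ` S)" using \<open>z \<in> S\<close> by (intro subsetD[OF closure_subset]) simp
    ultimately show ?thesis by blast
  qed
  then have "(\<Union>S\<in>\<F>. closure (\<phi> ` S)) = UNIV" by blast
  moreover have "\<not> meager_in euclidean (UNIV :: 'h set)"
    using open_meager_empty[of "UNIV :: 'h set"] by auto
  ultimately have "\<not> (\<forall>S\<in>\<F>. meager_in euclidean (closure (\<phi> ` S)))"
    using F(2) meager_in_Union[of "(\<lambda>S. closure (\<phi> ` S)) ` \<F>" euclidean] by auto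
  then obtain g where g: "interior (closure (\<phi> ` (+) g ` V)) \<noteq> {}"
    using F(1) meager_closed by blast
  define P where "P = interior (closure (\<phi> ` (+) g ` V))"
  have P: "open P" "P \<noteq> {}" "P \<subseteq> closure (\<phi> ` (+) g ` V)"
    using g by (auto simp: P_def interior_subset)
  then have "P \<inter> closure (\<phi> ` (+) g ` V) \<noteq> {}" by blast
  then have "P \<inter> \<phi> ` (+) g ` V \<noteq> {}" by (simp add: open_Int_closure_eq_empty P(1))
  then obtain v where v: "v \<in> V" "\<phi> (g + v) \<in> P" by blast
  define t where "t = \<phi> x - \<phi> (g + v)"
  have "(+) t ` closure (\<phi> ` (+) g ` V) \<subseteq> closure ((+) t ` \<phi> ` (+) g ` V)"
    by (intro image_closure_subset continuous_intros closed_closure closure_subset)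
  then have "(+) t ` P \<subseteq> closure ((+) t ` \<phi> ` (+) g ` V)"
    using image_mono[OF P(3)] by (rule order_trans[rotated])
  moreover have "(+) t ` \<phi> ` (+) g ` V \<subseteq> \<phi> ` W"
  proof safe
    fix w assume "w \<in> V"
    have "t = \<phi> x - \<phi> v - \<phi> g" by (simp add: t_def add diff_add_eq_diff_diff_swap)
    then have "t + \<phi> (g + w) = (\<phi> x - \<phi> v) + \<phi> w" by (simp add: add flip: add.assoc)
    also have "\<dots> = \<phi> (x + (- v + w))" by (simp add: add hom flip: add.assoc)
    finally show "t + \<phi> (g + w) \<in> \<phi> ` W" using V(3)[OF v(1) \<open>w \<in> V\<close>] by simp
  qed
  ultimately have "(+) t ` P \<subseteq> closure (\<phi> ` W)"
    by (rule order_trans[OF _ closure_mono])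
  moreover have "\<phi> x \<in> (+) t ` P"
    using v(2) by (auto simp: t_def intro!: image_eqI[of _ _ "\<phi> (g + v)"])
  ultimately show ?thesis
    by (intro subsetD[OF interior_maximal[OF _ open_translation_group[OF P(1)]]])
qed

text \<open>
  The image of a basic open set \<open>W\<close> is therefore comeager in \<open>interior (closure (\<phi> ` W))\<close>: cover
  \<open>W\<close> by smaller basic sets \<open>V\<close>; the sets \<open>interior (closure (\<phi> ` V))\<close> contain \<open>\<phi> ` V\<close> and
  cover \<open>interior (closure (\<phi> ` W))\<close> up to a nowhere dense set. A point outside all these countably
  many exceptional sets can be followed through a shrinking sequence of basic sets, whose limit is
  a preimage of it.
\<close>

lemma image_of_basis_comeager:
  fixes \<B> :: "'g set set"
  assumes \<B>: "countable \<B>" "topological_basis \<B>"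
  obtains M where "meager_in euclidean M"
    and "\<And>W. W \<in> \<B> \<Longrightarrow> interior (closure (\<phi> ` W)) \<subseteq> \<phi> ` W \<union> M"
proof -
  define O' where "O' W = interior (closure (\<phi> ` W))" for W
  define sub where "sub W n = {V \<in> \<B>. closure V \<subseteq> W \<and> (\<exists>x. V \<subseteq> ball x (1 / real (Suc n)))}" for W n
  define E where "E W n = O' W - \<Union>(O' ` sub W n)" for W n
  have op: "open W" if "W \<in> \<B>" for W using \<B>(2) that by (rule topological_basis_open)
  have "meager_in euclidean (E W n)" if W: "W \<in> \<B>" for W n
  proof -
    define Q where "Q = \<Union>(O' ` sub W n)"
    have "open Q" by (auto simp: Q_def O'_def)
    have "\<phi> x \<in> Q" if xW: "x \<in> W" for x
    proof -
      obtain V where V: "V \<in> \<B>" "x \<in> V" "closure V \<subseteq> W" "V \<subseteq> ball x (1 / real (Suc n))"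
        using refine_open_by_basis[OF \<B>(2) op[OF W] xW, of "1 / real (Suc n)"] zero_less_divide_1_iff of_nat_0_less_iff zero_less_Suc by metis
      then have "\<phi> x \<in> O' V" unfolding O'_def using nearly_open op by blast
      then show ?thesis using V unfolding Q_def sub_def by blast
    qed
    then have "closure (\<phi> ` W) \<subseteq> closure Q" by (intro closure_mono) auto
    then have OQ: "O' W \<subseteq> closure Q" unfolding O'_def by (rule order_trans[OF interior_subset])
    show ?thesis
    proof (rule meager_in_subset[OF meager_closed])
      show "E W n \<subseteq> closure Q - Q" using OQ by (auto simp: E_def Q_def)
      show "closed (closure Q - Q)" using \<open>open Q\<close> by (simp add: closed_Diff)
      have "interior (closure Q - Q) \<inter> Q = {}" using interior_subset[of "closure Q - Q"] by blast
      then have "interior (closure Q - Q) \<inter> closure Q = {}"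
        by (simp add: open_Int_closure_eq_empty)
      then show "interior (closure Q - Q) = {}" using interior_subset[of "closure Q - Q"] by blast
    qed
  qed
  then have M: "meager_in euclidean (\<Union>(W, n)\<in>\<B> \<times> UNIV. E W n)"
    using \<B>(1) by (intro meager_in_Union) auto
  have mem: "y \<in> \<phi> ` W" if W: "W \<in> \<B>" and y: "y \<in> O' W" and nE: "y \<notin> (\<Union>(W, n)\<in>\<B> \<times> UNIV. E W n)" for W y
  proof -
    define P where "P n V \<longleftrightarrow> V \<in> \<B> \<and> y \<in> O' V \<and> (n > 0 \<longrightarrow> (\<exists>x. V \<subseteq> ball x (1 / real n)))" for n V
    \<comment> \<open>Avoiding \<open>E V n\<close> is what allows the passage from \<open>V\<close> to a smaller basic set.\<close>
    have step: "\<exists>V'. P (Suc n) V' \<and> closure V' \<subseteq> V" if V: "P n V" for n V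
    proof -
      have "y \<notin> E V n" using nE V P_def by blast
      then obtain V' where "V' \<in> sub V n" "y \<in> O' V'"
        using V unfolding E_def P_def by blast
      then show ?thesis unfolding P_def sub_def by blast
    qed
    have "\<exists>V. \<forall>n. (P n (V n) \<and> (n = 0 \<longrightarrow> V n = W)) \<and> closure (V (Suc n)) \<subseteq> V n"
    proof (rule dependent_nat_choice)
      show "\<exists>V. P 0 V \<and> (0 = 0 \<longrightarrow> V = W)" using W y unfolding P_def by simp
      show "\<exists>V'. (P (Suc n) V' \<and> (Suc n = 0 \<longrightarrow> V' = W)) \<and> closure V' \<subseteq> V"
        if "P n V \<and> (n = 0 \<longrightarrow> V = W)" for V n
        using step that by auto
    qed
    then obtain V where V: "\<And>n. P n (V n) \<and> (n = 0 \<longrightarrow> V n = W)" "\<And>n. closure (V (Suc n)) \<subseteq> V n"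
      by blast
    have ne: "V n \<noteq> {}" and small: "\<exists>c. V (Suc n) \<subseteq> ball c (1 / real (Suc n))" for n
      using V(1)[of n] V(1)[of "Suc n"] unfolding P_def O'_def by auto
    obtain a where a: "\<And>n. a \<in> V n" "\<And>U. open U \<Longrightarrow> a \<in> U \<Longrightarrow> \<exists>n. V n \<subseteq> U"
      using nested_small_sets_limit[OF ne V(2) small] by blast
    \<comment> \<open>The sets \<open>\<phi> ` V n\<close> shrink to \<open>\<phi> a\<close>, and \<open>y\<close> lies in the closure of each of them.\<close>
    have "\<phi> a = y"
    proof (rule ccontr)
      assume "\<phi> a \<noteq> y"
      define e where "e = dist (\<phi> a) y / 2"
      have e: "e > 0" "y \<notin> cball (\<phi> a) e"
        using \<open>\<phi> a \<noteq> y\<close> by (auto simp: e_def not_le)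
      have "open (\<phi> -` ball (\<phi> a) e)" by (intro open_vimage cont) auto
      then obtain n where n: "V n \<subseteq> \<phi> -` ball (\<phi> a) e" using a(2) e(1) by force
      then have "closure (\<phi> ` V n) \<subseteq> cball (\<phi> a) e" by (intro closure_minimal) force+
      moreover have "y \<in> closure (\<phi> ` V n)"
        using V(1)[of n] interior_subset[of "closure (\<phi> ` V n)"] unfolding P_def O'_def by blast
      ultimately show False using e(2) by blast
    qed
    moreover have "a \<in> W" using a(1)[of 0] V(1)[of 0] by simp
    ultimately show ?thesis by blast
  qed
  show thesis
  proof (rule that[OF M])
    show "interior (closure (\<phi> ` W)) \<subseteq> \<phi> ` W \<union> (\<Union>(W, n)\<in>\<B> \<times> UNIV. E W n)" if "W \<in> \<B>" for W
      using mem[OF that] unfolding O'_def by (meson UnI1 UnI2 subsetI)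
  qed
qed

text \<open>
  Two comeager subsets of a nonempty open set meet, so every \<open>h\<close> in the
  neighbourhood \<open>interior (closure (\<phi> ` V))\<close> of \<open>0\<close> is a difference of elements of \<open>\<phi> ` V\<close>.
\<close>

theorem open_image_homomorphism:
  assumes "open W"
  shows "open (\<phi> ` W)"
proof -
  obtain \<B> :: "'g set set" where \<B>: "countable \<B>" "topological_basis \<B>"
    using ex_countable_basis by blast
  obtain M where M: "meager_in euclidean M"
    and im: "\<And>W. W \<in> \<B> \<Longrightarrow> interior (closure (\<phi> ` W)) \<subseteq> \<phi> ` W \<union> M"
    by (rule image_of_basis_comeager[OF \<B>]) (rule that)
  have "\<exists>T. open T \<and> \<phi> x \<in> T \<and> T \<subseteq> \<phi> ` W" if xW: "x \<in> W" for x
  proof -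
    have "continuous_on UNIV (\<lambda>p :: 'g \<times> 'g. x + (fst p - snd p))"
      by (intro continuous_intros)
    from open_square_in_vimage[OF this, of W 0] obtain A where A: "open A" "0 \<in> A"
      and W: "\<And>a b. a \<in> A \<Longrightarrow> b \<in> A \<Longrightarrow> x + (a - b) \<in> W"
      using assms xW by auto
    obtain V where V: "V \<in> \<B>" "0 \<in> V" "V \<subseteq> A"
      using topological_basisE[OF \<B>(2), of A 0] A by auto
    define Q where "Q = interior (closure (\<phi> ` V))"
    have Q: "open Q" "0 \<in> Q" "Q \<subseteq> \<phi> ` V \<union> M"
      using nearly_open[of V 0] V im topological_basis_open[OF \<B>(2)] hom
      by (auto simp: Q_def)
    have "\<phi> x + h \<in> \<phi> ` W" if h: "h \<in> Q" for h
    proof -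
      have "h \<in> (+) h ` Q \<inter> Q"
        using h Q(2) by (auto intro!: image_eqI[of _ _ 0])
      moreover have "open ((+) h ` Q \<inter> Q)" using Q(1) open_translation_group by blast
      moreover have "meager_in euclidean ((+) h ` M \<union> M)"
        by (intro meager_in_Un meager_homeomorphism[where k = "\<lambda>y. - h + y"] M)
           (auto simp: continuous_on_def intro!: tendsto_intros)
      ultimately obtain z where z: "z \<in> (+) h ` Q" "z \<in> Q" "z \<notin> (+) h ` M" "z \<notin> M"
        using open_meager_empty[of "(+) h ` Q \<inter> Q"] meager_in_subset[of _ "(+) h ` M \<union> M" "(+) h ` Q \<inter> Q"] by blast
      obtain v where v: "v \<in> V" "z = \<phi> v" using z Q(3) by blast
      obtain w where w: "w \<in> V" "z = h + \<phi> w" using z Q(3) by blast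
      have "h = \<phi> v - \<phi> w" using v(2) w(2) by (metis add_diff_cancel)
      then have "\<phi> x + h = \<phi> (x + (v - w))" by (simp add: add hom)
      moreover have "x + (v - w) \<in> W" using W V(3) v(1) w(1) by blast
      ultimately show ?thesis by simp
    qed
    then have "(+) (\<phi> x) ` Q \<subseteq> \<phi> ` W" by blast
    moreover have "\<phi> x \<in> (+) (\<phi> x) ` Q" using Q(2) by (auto intro!: image_eqI[of _ _ 0])
    ultimately show ?thesis using open_translation_group[OF Q(1)] by blast
  qed
  then show ?thesis by (subst open_subopen) blast
qed

end

section \<open>Preimages of meager sets are Haar meager\<close>

text \<open>
  Completeness of the domain lifts compact sets through an open map: shrink an open set that is mapped
  onto a superset of \<open>R\<close> repeatedly to finite unions of smaller and smaller balls; compactness of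
  \<open>R\<close> keeps the unions finite, and their intersection is the required compact set.
\<close>

lemma compact_lift_through_open_map:
  fixes \<phi> :: "'a::complete_space \<Rightarrow> 'b::metric_space"
  assumes cont: "continuous_on UNIV \<phi>" and op: "\<And>W. open W \<Longrightarrow> open (\<phi> ` W)"
    and R: "compact R" "R \<subseteq> range \<phi>"
  obtains C where "compact C" "R \<subseteq> \<phi> ` C"
proof -
  define small where
    "small n W \<longleftrightarrow> (\<exists>F. finite F \<and> W \<subseteq> (\<Union>c\<in>F. ball c (1 / real (Suc n))))" for n and W :: "'a set"
  have step: "\<exists>W'. open W' \<and> R \<subseteq> \<phi> ` W' \<and> small n W' \<and> closure W' \<subseteq> W"
    if W: "open W" "R \<subseteq> \<phi> ` W" for n W
  proof -
    have basis: "topological_basis {S :: 'a set. open S}"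
      by (intro topological_basisI) auto
    have "\<exists>V. open V \<and> x \<in> V \<and> closure V \<subseteq> W \<and> V \<subseteq> ball x (1 / real (Suc n))" if "x \<in> W" for x
    proof -
      have "0 < 1 / real (Suc n)" by simp
      from refine_open_by_basis[OF basis W(1) that this] show ?thesis by (metis mem_Collect_eq)
    qed
    then obtain V where V: "\<And>x. x \<in> W \<Longrightarrow> open (V x)" "\<And>x. x \<in> W \<Longrightarrow> x \<in> V x"
      "\<And>x. x \<in> W \<Longrightarrow> closure (V x) \<subseteq> W" "\<And>x. x \<in> W \<Longrightarrow> V x \<subseteq> ball x (1 / real (Suc n))"
      by metis
    have "R \<subseteq> (\<Union>x\<in>W. \<phi> ` V x)" using W(2) V(2) by blast
    then obtain F where F: "F \<subseteq> W" "finite F" "R \<subseteq> (\<Union>x\<in>F. \<phi> ` V x)"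
      using compactE_image[OF R(1), of W "\<lambda>x. \<phi> ` V x"] op V(1) by metis
    have "closure (\<Union>x\<in>F. V x) \<subseteq> (\<Union>x\<in>F. closure (V x))"
      using F(2) by (intro closure_minimal UN_mono closure_subset) auto
    then have "closure (\<Union>x\<in>F. V x) \<subseteq> W" using F(1) V(3) by blast
    moreover have "open (\<Union>x\<in>F. V x)" using F(1) V(1) by blast
    moreover have "R \<subseteq> \<phi> ` (\<Union>x\<in>F. V x)" using F(3) by blast
    moreover have "small n (\<Union>x\<in>F. V x)"
      unfolding small_def using F(1,2) V(4) by (intro exI[of _ F] conjI UN_mono) auto
    ultimately show ?thesis by blast
  qed
  have "\<exists>W. \<forall>n. (open (W n) \<and> R \<subseteq> \<phi> ` W n) \<and> (small n (W (Suc n)) \<and> closure (W (Suc n)) \<subseteq> W n)"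
  proof (rule dependent_nat_choice)
    show "\<exists>W. open W \<and> R \<subseteq> \<phi> ` W" using R(2) by blast
    show "\<exists>W'. (open W' \<and> R \<subseteq> \<phi> ` W') \<and> small n W' \<and> closure W' \<subseteq> W"
      if "open W \<and> R \<subseteq> \<phi> ` W" for W n
      using step[of W n] that by auto
  qed
  then obtain W where W: "\<And>n. R \<subseteq> \<phi> ` W n" "\<And>n. small n (W (Suc n))" "\<And>n. closure (W (Suc n)) \<subseteq> W n"
    by metis
  have Suc_sub: "W (Suc n) \<subseteq> W n" for n
    using closure_subset[of "W (Suc n)"] W(3)[of n] by (rule order_trans)
  have dec: "W n \<subseteq> W m" if "m \<le> n" for m n
    using Suc_sub that by (rule lift_Suc_antimono_le)
  have fine: "\<exists>n F. finite F \<and> W n \<subseteq> (\<Union>c\<in>F. ball c e)" if e: "e > 0" for e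
  proof -
    obtain n where n: "1 / real (Suc n) < e" using nat_approx_posE[OF e] by blast
    obtain F where "finite F" "W (Suc n) \<subseteq> (\<Union>c\<in>F. ball c (1 / real (Suc n)))"
      using W(2) unfolding small_def by blast
    moreover have "(\<Union>c\<in>F. ball c (1 / real (Suc n))) \<subseteq> (\<Union>c\<in>F. ball c e)"
      using n by (intro UN_mono subset_ball) auto
    ultimately show ?thesis by (meson order_trans)
  qed
  define C where "C = (\<Inter>n. closure (W n))"
  have CW: "C \<subseteq> W n" for n using W(3)[of n] unfolding C_def by blast
  show thesis
  proof (rule that)
    have "closed C" by (auto simp: C_def)
    moreover have "\<exists>F. finite F \<and> C \<subseteq> (\<Union>c\<in>F. ball c e)" if "e > 0" for e
      using fine[OF that] CW by (meson order_trans)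
    ultimately show "compact C"
      by (simp add: compact_eq_totally_bounded complete_eq_closed)
    \<comment> \<open>Pick preimages of a point of \<open>R\<close> in every \<open>W n\<close>: they form a totally bounded sequence, and
      any cluster point of it lies in \<open>C\<close> over the same point.\<close>
    show "R \<subseteq> \<phi> ` C"
    proof
      fix y assume "y \<in> R"
      then have "\<exists>x. x \<in> W n \<and> \<phi> x = y" for n using W(1)[of n] by blast
      then obtain x where x: "\<And>n. x n \<in> W n" "\<And>n. \<phi> (x n) = y" by metis
      have "\<exists>F. finite F \<and> closure (range x) \<subseteq> (\<Union>c\<in>F. ball c e)" if e: "e > 0" for e
      proof -
        obtain n F where F: "finite F" "W n \<subseteq> (\<Union>c\<in>F. ball c (e / 2))" using fine[of "e / 2"] e by auto
        have "range x \<subseteq> (\<Union>c\<in>F \<union> x ` {..n}. cball c (e / 2))"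
        proof safe
          fix m
          show "x m \<in> (\<Union>c\<in>F \<union> x ` {..n}. cball c (e / 2))"
          proof (cases "m \<le> n")
            case True
            then show ?thesis using e by (intro UN_I[of "x m"]) auto
          next
            case False
            then have "x m \<in> W n" using dec[of n m] x(1) by auto
            then obtain c where "c \<in> F" "x m \<in> ball c (e / 2)" using F(2) by blast
            then show ?thesis by (intro UN_I[of c]) auto
          qed
        qed
        then have "closure (range x) \<subseteq> (\<Union>c\<in>F \<union> x ` {..n}. cball c (e / 2))"
          using F(1) by (intro closure_minimal) auto
        moreover have "(\<Union>c\<in>F \<union> x ` {..n}. cball c (e / 2)) \<subseteq> (\<Union>c\<in>F \<union> x ` {..n}. ball c e)"
          using e by (intro UN_mono) auto
        ultimately have "closure (range x) \<subseteq> (\<Union>c\<in>F \<union> x ` {..n}. ball c e)"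
          by (rule order_trans)
        then show ?thesis using F(1) by (intro exI[of _ "F \<union> x ` {..n}"] conjI) auto
      qed
      then have "compact (closure (range x))"
        by (simp add: compact_eq_totally_bounded complete_eq_closed)
      then have "seq_compact (closure (range x))" by (rule compact_imp_seq_compact)
      moreover have "\<forall>n. x n \<in> closure (range x)" using closure_subset[of "range x"] by auto
      ultimately obtain l r where r: "strict_mono (r :: nat \<Rightarrow> nat)" "(x \<circ> r) \<longlonglongrightarrow> l"
        by (rule seq_compactE)
      have "l \<in> closure (W n)" for n
      proof (rule Lim_in_closed_set[OF closed_closure _ _ r(2)])
        show "\<forall>\<^sub>F k in sequentially. (x \<circ> r) k \<in> closure (W n)"
        proof (rule eventually_sequentiallyI[of n])
          fix k assume "n \<le> k"
          then have "n \<le> r k" using seq_suble[OF r(1), of k] by simp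
          then show "(x \<circ> r) k \<in> closure (W n)"
            using dec x(1)[of "r k"] closure_subset[of "W n"] by auto
        qed
      qed auto
      then have "l \<in> C" by (simp add: C_def)
      have "(\<lambda>k. \<phi> ((x \<circ> r) k)) \<longlonglongrightarrow> \<phi> l"
        by (rule continuous_on_tendsto_compose[OF cont r(2)]) auto
      then have "\<phi> l = y" using x(2) by (simp add: LIMSEQ_const_iff)
      then show "y \<in> \<phi> ` C" using \<open>l \<in> C\<close> by blast
    qed
  qed
qed

text \<open>
  Take \<open>K\<close> minimal among the closed subsets of \<open>C\<close> whose image still covers \<open>U\<close>; compactness makes
  Zorn's lemma applicable, here to the open sets removed from \<open>C\<close>. If \<open>V\<close> meets \<open>K\<close>, the image of
  \<open>K - V\<close> is closed and misses a nonempty open part of \<open>U\<close>, which must then be covered by the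
  image of \<open>V \<inter> K\<close>.
\<close>

lemma irreducible_compact_lift:
  fixes \<phi> :: "'a::t2_space \<Rightarrow> 'b::t2_space"
  assumes cont: "continuous_on UNIV \<phi>" and C: "compact C" and U: "open U" "U \<subseteq> \<phi> ` C"
  obtains K where "compact K" "U \<subseteq> \<phi> ` K"
    and "\<And>V. open V \<Longrightarrow> V \<inter> K \<noteq> {} \<Longrightarrow> \<exists>T. open T \<and> T \<noteq> {} \<and> T \<subseteq> \<phi> ` (V \<inter> K)"
proof -
  define \<A> where "\<A> = {X. open X \<and> U \<subseteq> \<phi> ` (C - X)}"
  have "\<exists>M\<in>\<A>. \<forall>X\<in>\<A>. M \<subseteq> X \<longrightarrow> X = M"
  proof (rule subset_Zorn)
    fix \<C> assume ch: "subset.chain \<A> \<C>"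
    then have sub: "\<C> \<subseteq> \<A>" by (simp add: subset_chain_def)
    show "\<exists>X\<in>\<A>. \<forall>Y\<in>\<C>. Y \<subseteq> X"
    proof (cases "\<C> = {}")
      case True
      have "{} \<in> \<A>" using U(2) by (simp add: \<A>_def)
      then show ?thesis using True by blast
    next
      case False
      have "y \<in> \<phi> ` (C - \<Union>\<C>)" if y: "y \<in> U" for y
      proof (rule ccontr)
        assume "y \<notin> \<phi> ` (C - \<Union>\<C>)"
        then have cover: "C \<inter> \<phi> -` {y} \<subseteq> \<Union>\<C>" by blast
        have "closed (\<phi> -` {y})" by (intro closed_vimage cont) auto
        then have "compact (C \<inter> \<phi> -` {y})" using C by (rule compact_Int_closed[rotated])
        moreover have "\<And>X. X \<in> \<C> \<Longrightarrow> open X" using sub by (auto simp: \<A>_def)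
        ultimately obtain \<D> where D: "\<D> \<subseteq> \<C>" "finite \<D>" "C \<inter> \<phi> -` {y} \<subseteq> \<Union>\<D>"
          using compactE[OF _ cover] by metis
        \<comment> \<open>A finite subcover of the fibre would be contained in a single member of the chain.\<close>
        have "\<exists>X\<in>\<C>. \<Union>\<D> \<subseteq> X"
        proof (cases "\<D> = {}")
          case True
          then show ?thesis using \<open>\<C> \<noteq> {}\<close> by auto
        next
          case False
          have "subset.chain \<A> \<D>" using ch D(1) unfolding subset_chain_def by (meson subset_iff)
          then have "\<Union>\<D> \<in> \<D>" by (rule Union_in_chain[OF D(2) False])
          then show ?thesis using D(1) by blast
        qed
        then obtain X where X: "X \<in> \<C>" "\<Union>\<D> \<subseteq> X" by (rule bexE)
        have "X \<in> \<A>" using X(1) sub by (rule subsetD[rotated])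
        then have "y \<in> \<phi> ` (C - X)" using y unfolding \<A>_def by blast
        then show False using D(3) X(2) by blast
      qed
      then have "U \<subseteq> \<phi> ` (C - \<Union>\<C>)" by (rule subsetI)
      moreover have "open (\<Union>\<C>)" using sub by (intro open_Union) (auto simp: \<A>_def)
      ultimately have "\<Union>\<C> \<in> \<A>" by (simp add: \<A>_def)
      then show ?thesis by blast
    qed
  qed
  then obtain X where X: "X \<in> \<A>" "\<And>Y. Y \<in> \<A> \<Longrightarrow> X \<subseteq> Y \<Longrightarrow> Y = X" by metis
  then have oX: "open X" "U \<subseteq> \<phi> ` (C - X)" by (auto simp: \<A>_def)
  show thesis
  proof (rule that)
    show "compact (C - X)" using C oX(1) by (rule compact_diff)
    show "U \<subseteq> \<phi> ` (C - X)" by (rule oX(2))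
    fix V assume V: "open V" "V \<inter> (C - X) \<noteq> {}"
    then have "X \<union> V \<noteq> X" by blast
    then have "X \<union> V \<notin> \<A>" using X(2)[of "X \<union> V"] by blast
    then have ne: "U - \<phi> ` (C - (X \<union> V)) \<noteq> {}" using oX(1) V(1) by (auto simp: \<A>_def)
    have "compact (C - (X \<union> V))" using C oX(1) V(1) by (intro compact_diff) auto
    then have "compact (\<phi> ` (C - (X \<union> V)))"
      by (intro compact_continuous_image continuous_on_subset[OF cont]) auto
    then have "open (U - \<phi> ` (C - (X \<union> V)))" using U(1) by (intro open_Diff compact_imp_closed)
    moreover have "U - \<phi> ` (C - (X \<union> V)) \<subseteq> \<phi> ` (V \<inter> (C - X))" using oX(2) by blast
    ultimately show "\<exists>T. open T \<and> T \<noteq> {} \<and> T \<subseteq> \<phi> ` (V \<inter> (C - X))" using ne by blast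
  qed
qed

text \<open>
  The witness is the inclusion of the compact set \<open>K\<close> obtained from a compact neighbourhood \<open>R\<close> of
  \<open>0\<close>. The preimage in \<open>K\<close> of a translate of a closed nowhere dense set contains no
  nonempty relatively open set, because images of those have interior points.
\<close>

theorem haar_meager_vimage_meager:
  fixes \<phi> :: "'g::{topological_group_add, polish_space} \<Rightarrow> 'h::{topological_group_add, polish_space}"
  assumes cont: "continuous_on UNIV \<phi>"
    and surj: "surj \<phi>"
    and add: "\<And>x y. \<phi> (x + y) = \<phi> x + \<phi> y"
    and lc: "locally_compact_space (euclidean :: 'h topology)"
    and M: "meager_in euclidean M"
  shows "haar_meager (\<phi> -` M)"
proof -
  have "\<exists>U R :: 'h set. open U \<and> compact R \<and> 0 \<in> U \<and> U \<subseteq> R"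
    using lc unfolding locally_compact_space_def by simp
  then obtain U R :: "'h set" where U: "open U" "0 \<in> U" "U \<subseteq> R" "compact R"
    by (elim exE conjE) (rule that)
  obtain C where C: "compact C" "R \<subseteq> \<phi> ` C"
  proof (rule compact_lift_through_open_map[OF cont open_image_homomorphism[OF cont surj add] U(4)])
    show "R \<subseteq> range \<phi>" using surj by simp
  qed (assumption, rule that)
  have "U \<subseteq> \<phi> ` C" using U(3) C(2) by (rule order_trans)
  then obtain K where K: "compact K" "U \<subseteq> \<phi> ` K"
    and fat: "\<And>V. open V \<Longrightarrow> V \<inter> K \<noteq> {} \<Longrightarrow> \<exists>T. open T \<and> T \<noteq> {} \<and> T \<subseteq> \<phi> ` (V \<inter> K)"
    by (rule irreducible_compact_lift[OF cont C(1) U(1)]) (rule that)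
  obtain \<F> where F': "countable \<F>" "\<forall>F\<in>\<F>. closed F \<and> interior F = {}" "M \<subseteq> \<Union>\<F>"
    using M unfolding meager_euclidean_iff by (elim exE conjE) (rule that)
  have F: "countable \<F>" "\<And>F. F \<in> \<F> \<Longrightarrow> closed F" "\<And>F. F \<in> \<F> \<Longrightarrow> interior F = {}" "M \<subseteq> \<Union>\<F>"
    using F' by auto
  show ?thesis
  proof (rule haar_meagerI)
    show "topspace (top_of_set K) \<noteq> {}" using K(2) U(2) by auto
    show "compact_space (top_of_set K)" using K(1) by (simp add: compact_space_subtopology)
    show "metrizable_space (top_of_set K)" by (simp add: metrizable_space_subtopology metrizable_space_euclidean)
    show "continuous_map (top_of_set K) euclidean (\<lambda>x. x)" by simp
    show "\<phi> -` \<Union>\<F> \<in> sets borel"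
    proof -
      have "\<phi> -` F \<in> sets borel" if "F \<in> \<F>" for F
        using F(2)[OF that] cont by (intro borel_closed closed_vimage)
      then have "(\<Union>F\<in>\<F>. \<phi> -` F) \<in> sets borel" using F(1) by (intro sets.countable_UN') auto
      then show ?thesis by (simp add: vimage_Union)
    qed
    show "\<phi> -` M \<subseteq> \<phi> -` \<Union>\<F>" using F(4) by blast
    fix g h
    define tr where "tr F = (\<lambda>y. \<phi> g + y + \<phi> h) ` F" for F
    have vim: "tr F = (\<lambda>y. - \<phi> g + (y - \<phi> h)) -` F" for F
      by (auto simp: tr_def algebra_simps add.assoc intro!: image_eqI[of _ _ "- \<phi> g + (y - \<phi> h)" for y])
    have cl: "closed (tr F)" if "F \<in> \<F>" for F
      unfolding vim using F(2)[OF that] by (intro closed_vimage continuous_intros)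
    have mg: "meager_in euclidean (tr F)" if "F \<in> \<F>" for F
      unfolding tr_def
      by (intro meager_homeomorphism[where k = "\<lambda>y. - \<phi> g + (y - \<phi> h)"] continuous_intros
          meager_closed F that) auto
    have "meager_in (top_of_set K) (K \<inter> \<phi> -` tr F)" if "F \<in> \<F>" for F
    proof (rule meager_in_closed)
      show "closedin (top_of_set K) (K \<inter> \<phi> -` tr F)"
        using cl[OF that] cont by (intro closedin_closed_Int closed_vimage)
      have "S = {}" if S: "openin (top_of_set K) S" "S \<subseteq> K \<inter> \<phi> -` tr F" for S
      proof (rule ccontr)
        assume "S \<noteq> {}"
        obtain V where V: "open V" "S = V \<inter> K" using S(1) by (auto simp: openin_subtopology)
        obtain T where T: "open T" "T \<noteq> {}" "T \<subseteq> \<phi> ` (V \<inter> K)" using fat[OF V(1)] V(2) \<open>S \<noteq> {}\<close> by blast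
        have "T \<subseteq> tr F" using T(3) S(2) V(2) by blast
        then show False
          using open_meager_empty[OF T(1) meager_in_subset[OF mg[OF \<open>F \<in> \<F>\<close>]]] T(2) by blast
      qed
      from this[OF openin_interior_of interior_of_subset]
      show "top_of_set K interior_of (K \<inter> \<phi> -` tr F) = {}" .
    qed
    then have "meager_in (top_of_set K) (\<Union>F\<in>\<F>. K \<inter> \<phi> -` tr F)"
      using F(1) by (intro meager_in_Union) auto
    moreover have "{x \<in> topspace (top_of_set K). x \<in> (\<lambda>b. g + b + h) ` (\<phi> -` \<Union>\<F>)} \<subseteq> (\<Union>F\<in>\<F>. K \<inter> \<phi> -` tr F)"
      by (auto simp: tr_def add)
    ultimately show "meager_in (top_of_set K) {x \<in> topspace (top_of_set K). x \<in> (\<lambda>b. g + b + h) ` (\<phi> -` \<Union>\<F>)}"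
      by (rule meager_in_subset)
  qed
qed

section \<open>Functions between Polish spaces that pull back meager sets to meager sets\<close>

text \<open>
  A maximal disjoint family of small open subsets of \<open>U\<close> has dense union. Requiring that
  their closures avoid a fixed point \<open>x\<close> of \<open>U\<close> forces the family to be infinite, since finitely
  many such closures would leave a neighbourhood of \<open>x\<close> uncovered; as \<open>x\<close> is not isolated, this
  restriction does not affect density.
\<close>

lemma dense_open_partition:
  fixes U :: "'a::{metric_space, second_countable_topology} set"
  assumes perfect: "\<And>x :: 'a. \<not> open {x}" and U: "open U" "U \<noteq> {}" and e: "e > 0"
  shows "\<exists>P :: nat \<Rightarrow> 'a set. (\<forall>i. open (P i) \<and> P i \<noteq> {} \<and> P i \<subseteq> U \<and> (\<exists>c. P i \<subseteq> ball c e)) \<and>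
     disjoint_family P \<and> U \<subseteq> closure (\<Union>i. P i)"
proof -
  obtain x where x: "x \<in> U" using U(2) by blast
  obtain \<B> :: "'a set set" where \<B>: "topological_basis \<B>"
    using ex_countable_basis by blast
  define \<O> where "\<O> = {S. open S \<and> S \<noteq> {} \<and> S \<subseteq> U \<and> x \<notin> closure S \<and> (\<exists>c. S \<subseteq> ball c e)}"
  define \<A> where "\<A> = {\<F>. \<F> \<subseteq> \<O> \<and> pairwise disjnt \<F>}"
  have "\<exists>M\<in>\<A>. \<forall>\<F>\<in>\<A>. M \<subseteq> \<F> \<longrightarrow> \<F> = M"
  proof (rule subset_Zorn')
    fix \<C> assume ch: "subset.chain \<A> \<C>"
    then have sub: "\<C> \<subseteq> \<A>" by (simp add: subset_chain_def)
    then have "\<Union>\<C> \<subseteq> \<O>" by (auto simp: \<A>_def)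
    moreover have "pairwise disjnt (\<Union>\<C>)"
    proof (rule pairwise_chain_Union)
      show "pairwise disjnt \<F>" if "\<F> \<in> \<C>" for \<F> using that sub by (auto simp: \<A>_def)
      show "chain\<^sub>\<subseteq> \<C>" using ch by (simp add: chain_subset_def subset_chain_def)
    qed
    ultimately show "\<Union>\<C> \<in> \<A>" by (simp add: \<A>_def)
  qed
  then obtain M where M: "M \<in> \<A>" and max: "\<And>\<F>. \<F> \<in> \<A> \<Longrightarrow> M \<subseteq> \<F> \<Longrightarrow> \<F> = M" by metis
  have sub: "\<And>S. S \<in> M \<Longrightarrow> S \<in> \<O>" and pw: "pairwise disjnt M" using M by (auto simp: \<A>_def)
  have dense: "U \<subseteq> closure (\<Union>M)"
  proof (rule ccontr)
    assume "\<not> U \<subseteq> closure (\<Union>M)"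
    then have ne: "U - closure (\<Union>M) \<noteq> {}" by blast
    have "open (U - closure (\<Union>M))" using U(1) by (intro open_Diff) auto
    then have "U - closure (\<Union>M) \<noteq> {x}" using perfect[of x] by metis
    then obtain y where y: "y \<in> U - closure (\<Union>M) - {x}" using ne by blast
    have "open (U - closure (\<Union>M) - {x})" using U(1) by (intro open_Diff) auto
    from refine_open_by_basis[OF \<B> this y e]
    obtain V where "V \<in> \<B>" and V': "y \<in> V" "closure V \<subseteq> U - closure (\<Union>M) - {x}" "V \<subseteq> ball y e" .
    then have V: "open V" "y \<in> V" "closure V \<subseteq> U - closure (\<Union>M) - {x}" "V \<subseteq> ball y e"
      using topological_basis_open[OF \<B>] by simp_all
    have "V \<subseteq> closure V" by (rule closure_subset)
    then have "V \<in> \<O>" using V unfolding \<O>_def by blast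
    have d: "disjnt V S" if "S \<in> M" for S
    proof -
      have "S \<subseteq> closure (\<Union>M)" using that closure_subset[of "\<Union>M"] by blast
      then show ?thesis using V(3) \<open>V \<subseteq> closure V\<close> unfolding disjnt_def by blast
    qed
    then have "insert V M \<in> \<A>"
      using \<open>V \<in> \<O>\<close> sub pw by (auto simp: \<A>_def pairwise_insert disjnt_sym)
    then have "V \<in> M" using max[of "insert V M"] by blast
    then show False using d V(2) by (auto simp: disjnt_def)
  qed
  have "infinite M"
  proof
    assume "finite M"
    then have "closure (\<Union>M) \<subseteq> (\<Union>S\<in>M. closure S)"
      using closure_subset by (intro closure_minimal) auto
    then obtain S where "S \<in> M" "x \<in> closure S" using dense x by blast
    then show False using sub[of S] by (simp add: \<O>_def)
  qed
  moreover have "countable M"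
    by (rule countable_disjoint_open_subsets[OF _ pw]) (use sub in \<open>auto simp: \<O>_def\<close>)
  ultimately have bij: "bij_betw (from_nat_into M) UNIV M" by (rule bij_betw_from_nat_into[rotated])
  have P: "from_nat_into M i \<in> M" for i using bij by (auto simp: bij_betw_def)
  have "(\<Union>i. from_nat_into M i) = \<Union>M" using bij by (simp add: bij_betw_def)
  moreover have "disjoint_family (from_nat_into M)"
    using pw P bij unfolding disjoint_family_on_def pairwise_def disjnt_def bij_betw_def inj_def by metis
  ultimately show ?thesis
    using sub[OF P] dense by (intro exI[of _ "from_nat_into M"]) (auto simp: \<O>_def)
qed

text \<open>
  A countable basis is filtered for small sets well inside \<open>V\<close>. That every open set meeting
  \<open>V\<close> contains one of the pieces entirely is what makes a single branching step suffice
  to avoid a given nowhere dense set.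
\<close>

lemma small_open_subsets_sequence:
  fixes V :: "'a::{metric_space, second_countable_topology} set"
  assumes V: "open V" "V \<noteq> {}" and e: "e > 0"
  shows "\<exists>Q :: nat \<Rightarrow> 'a set.
     (\<forall>i. open (Q i) \<and> Q i \<noteq> {} \<and> closure (Q i) \<subseteq> V \<and> (\<exists>c. Q i \<subseteq> ball c e)) \<and>
     (\<forall>W. open W \<longrightarrow> W \<inter> V \<noteq> {} \<longrightarrow> (\<exists>i. Q i \<subseteq> W))"
proof -
  obtain \<B> :: "'a set set" where \<B>: "countable \<B>" "topological_basis \<B>"
    using ex_countable_basis by blast
  define \<S> where "\<S> = {S \<in> \<B>. S \<noteq> {} \<and> closure S \<subseteq> V \<and> (\<exists>c. S \<subseteq> ball c e)}"
  have ex: "\<exists>S\<in>\<S>. S \<subseteq> W" if W: "open W" "W \<inter> V \<noteq> {}" for W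
  proof -
    obtain x where x: "x \<in> W \<inter> V" using W(2) by blast
    have "open (W \<inter> V)" using W(1) V(1) by blast
    from refine_open_by_basis[OF \<B>(2) this x e]
    obtain S where S: "S \<in> \<B>" "x \<in> S" "closure S \<subseteq> W \<inter> V" "S \<subseteq> ball x e" .
    moreover have "S \<subseteq> closure S" by (rule closure_subset)
    ultimately show ?thesis unfolding \<S>_def by blast
  qed
  have "countable \<S>" using \<B>(1) unfolding \<S>_def by simp
  moreover have "\<S> \<noteq> {}" using ex[of UNIV] V(2) by auto
  ultimately have r: "range (from_nat_into \<S>) = \<S>" by (simp add: range_from_nat_into)
  have Q: "from_nat_into \<S> i \<in> \<S>" for i using r by blast
  have op: "open S" if "S \<in> \<S>" for S
    using that topological_basis_open[OF \<B>(2)] by (simp add: \<S>_def)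
  show ?thesis
  proof (intro exI[of _ "from_nat_into \<S>"] conjI allI impI)
    fix i
    show "open (from_nat_into \<S> i)" by (rule op[OF Q])
    show "from_nat_into \<S> i \<noteq> {}" "closure (from_nat_into \<S> i) \<subseteq> V"
      "\<exists>c. from_nat_into \<S> i \<subseteq> ball c e"
      using Q[of i] by (auto simp: \<S>_def)
  next
    fix W assume "open W" "W \<inter> V \<noteq> {}"
    then obtain S where S: "S \<in> \<S>" "S \<subseteq> W" using ex by blast
    then obtain i where "S = from_nat_into \<S> i" using r by blast
    then show "\<exists>i. from_nat_into \<S> i \<subseteq> W" using S(2) by blast
  qed
qed

text \<open>
  Two trees of open sets indexed by finite sequences are matched: \<open>U s\<close> in the domain,
  where each node splits into disjoint small pieces with dense union, and \<open>V s\<close> in the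
  codomain, where the children of a node include a subset of every open set that meets it.
  A generic point lies on exactly one branch of the first tree and is sent to the
  point to which the same branch of the second tree shrinks. If \<open>F\<close> is closed and
  nowhere dense, any \<open>U s\<close> has a child whose partner \<open>V (i # s)\<close> avoids \<open>F\<close>, so
  generic points of a dense open set are mapped outside \<open>F\<close>.
\<close>

theorem ex_meager_preserving_vimage:
  assumes perfect: "\<And>x :: 'a::{metric_space, second_countable_topology}. \<not> open {x}"
  shows "\<exists>\<alpha> :: 'a \<Rightarrow> 'b::polish_space.
    \<forall>M. meager_in euclidean M \<longrightarrow> meager_in euclidean (\<alpha> -` M)"
proof -
  have pos: "1 / real (Suc n) > 0" for n by simp
  define part where "part n U P \<longleftrightarrow>
    (\<forall>i. open (P i) \<and> P i \<noteq> {} \<and> P i \<subseteq> U \<and> (\<exists>c. P i \<subseteq> ball c (1 / real (Suc n)))) \<and>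
     disjoint_family P \<and> U \<subseteq> closure (\<Union>i. P i)" for n U and P :: "nat \<Rightarrow> 'a set"
  define children where "children n V Q \<longleftrightarrow>
    (\<forall>i. open (Q i) \<and> Q i \<noteq> {} \<and> closure (Q i) \<subseteq> V \<and> (\<exists>c. Q i \<subseteq> ball c (1 / real (Suc n)))) \<and>
     (\<forall>W. open W \<longrightarrow> W \<inter> V \<noteq> {} \<longrightarrow> (\<exists>i. Q i \<subseteq> W))" for n V and Q :: "nat \<Rightarrow> 'b set"
  define P where "P n U = (SOME P. part n U P)" for n U
  define Q where "Q n V = (SOME Q. children n V Q)" for n V
  have "part n U (P n U)" if "open U" "U \<noteq> {}" for n U
    unfolding P_def using dense_open_partition[OF perfect that pos, of n]
    by (intro someI_ex[of "part n U"]) (simp add: part_def)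
  then have P: "open (P n U i) \<and> P n U i \<noteq> {} \<and> P n U i \<subseteq> U \<and> (\<exists>c. P n U i \<subseteq> ball c (1 / real (Suc n)))"
    "disjoint_family (P n U) \<and> U \<subseteq> closure (\<Union>i. P n U i)" if "open U" "U \<noteq> {}" for n U i
    using that unfolding part_def by simp_all
  have "children n V (Q n V)" if "open V" "V \<noteq> {}" for n V
    unfolding Q_def using small_open_subsets_sequence[OF that pos, of n]
    by (intro someI_ex[of "children n V"]) (simp add: children_def)
  then have Q: "open (Q n V i) \<and> Q n V i \<noteq> {} \<and> closure (Q n V i) \<subseteq> V \<and> (\<exists>c. Q n V i \<subseteq> ball c (1 / real (Suc n)))"
    "open W \<Longrightarrow> W \<inter> V \<noteq> {} \<Longrightarrow> \<exists>i. Q n V i \<subseteq> W" if "open V" "V \<noteq> {}" for n V i W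
    using that unfolding children_def by simp_all
  \<comment> \<open>Sequences grow at the head, so the children of \<open>s\<close> are the lists \<open>i # s\<close>.\<close>
  define U where "U = rec_list UNIV (\<lambda>i s u. P (length s) u i)"
  define V where "V = rec_list UNIV (\<lambda>i s v. Q (length s) v i)"
  have U_simps: "U [] = UNIV" "U (i # s) = P (length s) (U s) i" for i s by (simp_all add: U_def)
  have V_simps: "V [] = UNIV" "V (i # s) = Q (length s) (V s) i" for i s by (simp_all add: V_def)
  have U: "open (U s)" "U s \<noteq> {}" for s
    by (induction s) (use P(1) in \<open>auto simp: U_simps\<close>)
  have V: "open (V s)" "V s \<noteq> {}" for s
    by (induction s) (use Q(1) in \<open>auto simp: V_simps\<close>)
  have U_sub: "U (i # s) \<subseteq> U s" for i s using P(1)[OF U] by (simp add: U_simps)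
  have V_sub: "closure (V (i # s)) \<subseteq> V s" for i s using Q(1)[OF V] by (simp add: V_simps)
  have U_small: "\<exists>c. U s \<subseteq> ball c (1 / real n)" if "length s = n" "n > 0" for s n
    using that P(1)[OF U] by (cases s) (auto simp: U_simps)
  have V_small: "\<exists>c. V s \<subseteq> ball c (1 / real n)" if "length s = n" "n > 0" for s n
    using that Q(1)[OF V] by (cases s) (auto simp: V_simps)
  have U_dense: "U s \<subseteq> closure (\<Union>i. U (i # s))" for s using P(2)[OF U] by (simp add: U_simps)
  have U_disj: "s = t" if "length s = length t" "x \<in> U s" "x \<in> U t" for s t x
    using that
  proof (induction s t rule: list_induct2)
    case (Cons i s j t)
    then have "s = t" using U_sub by blast
    moreover from this have "i = j"
      using Cons.prems P(2)[OF U, of "length t" t] unfolding U_simps disjoint_family_on_def by blast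
    ultimately show ?case by simp
  qed simp
  define G where "G n = \<Union>(U ` {s. length s = n})" for n
  have G_open: "open (G n)" for n using U(1) by (auto simp: G_def)
  have G_dense: "closure (G n) = UNIV" for n
  proof (induction n)
    case (Suc n)
    have "U s \<subseteq> closure (G (Suc n))" if "length s = n" for s
    proof (rule order_trans[OF U_dense closure_mono])
      show "(\<Union>i. U (i # s)) \<subseteq> G (Suc n)" using that unfolding G_def by force
    qed
    then have "G n \<subseteq> closure (G (Suc n))" by (auto simp: G_def)
    then have "closure (G n) \<subseteq> closure (G (Suc n))" by (simp add: closure_minimal)
    with Suc show ?case by auto
  qed (simp add: G_def U_simps)
  have \<pi>base: "\<exists>s. U s \<subseteq> W" if W: "open W" "W \<noteq> {}" for W
  proof -
    obtain y where "y \<in> W" using W(2) by blast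
    with W(1) obtain r where r: "r > 0" "ball y r \<subseteq> W" by (rule openE)
    obtain n where n: "1 / real (Suc n) < r / 4" using nat_approx_posE[of "r / 4"] r(1) by auto
    have "ball y (r / 2) \<inter> closure (G (Suc n)) \<noteq> {}" using r(1) G_dense by simp
    then have "ball y (r / 2) \<inter> G (Suc n) \<noteq> {}" by (simp add: open_Int_closure_eq_empty)
    then obtain z s where z: "z \<in> ball y (r / 2)" "z \<in> U s" "length s = Suc n" by (auto simp: G_def)
    obtain c where c: "U s \<subseteq> ball c (1 / real (Suc n))" using U_small[OF z(3) zero_less_Suc] by blast
    have "U s \<subseteq> ball y r"
    proof
      fix w assume "w \<in> U s"
      then have "dist c w < r / 4" "dist c z < r / 4" using c z(2) n by fastforce+
      then have "dist z w < r / 2" using dist_triangle3[of z w c] by simp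
      then show "w \<in> ball y r" using z(1) dist_triangle[of y w z] by simp
    qed
    then show ?thesis using r(2) by blast
  qed
  have lim: "\<exists>y. \<forall>s. x \<in> U s \<longrightarrow> y \<in> V s" if x: "\<And>n. x \<in> G n" for x
  proof -
    have "\<exists>s. length s = n \<and> x \<in> U s" for n using x[of n] by (auto simp: G_def)
    then obtain b where b: "\<And>n. length (b n) = n" "\<And>n. x \<in> U (b n)" by metis
    have b_Suc: "\<exists>i. b (Suc n) = i # b n" for n
    proof -
      obtain i t where it: "b (Suc n) = i # t" "length t = n" using b(1)[of "Suc n"] by (auto simp: length_Suc_conv)
      then have "x \<in> U t" using b(2)[of "Suc n"] U_sub by auto
      then have "t = b n" using U_disj[of t "b n" x] b it(2) by simp
      with it show ?thesis by simp
    qed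
    have "closure (V (b (Suc n))) \<subseteq> V (b n)" for n by (metis b_Suc V_sub)
    moreover have "\<exists>c. V (b (Suc n)) \<subseteq> ball c (1 / real (Suc n))" for n
      using V_small[OF b(1)[of "Suc n"] zero_less_Suc] .
    ultimately obtain y where y: "\<And>n. y \<in> V (b n)"
      by (rule nested_small_sets_limit[of "\<lambda>n. V (b n)", OF V(2)]) (rule that)
    have "y \<in> V s" if "x \<in> U s" for s
      using U_disj[of s "b (length s)" x] that b y[of "length s"] by simp
    then show ?thesis by blast
  qed
  define \<alpha> where "\<alpha> x = (SOME y. \<forall>s. x \<in> U s \<longrightarrow> y \<in> V s)" for x
  have \<alpha>: "\<alpha> x \<in> V s" if "\<And>n. x \<in> G n" "x \<in> U s" for x s
    using someI_ex[OF lim[OF that(1)]] that(2) unfolding \<alpha>_def by blast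
  have codense: "meager_in euclidean (- S)" if "open S" "closure S = UNIV" for S :: "'a set"
    using that by (intro meager_closed) (auto simp: interior_complement)
  have null: "meager_in euclidean (\<Union>n. - G n)"
    using codense[OF G_open G_dense] by (intro meager_in_Union) auto
  have rest: "meager_in euclidean (\<alpha> -` F - (\<Union>n. - G n))" if F: "closed F" "interior F = {}" for F
  proof -
    define H where "H = \<Union>(U ` {s. V s \<subseteq> - F})"
    have "W \<inter> H \<noteq> {}" if W: "open W" "W \<noteq> {}" for W
    proof -
      obtain s where s: "U s \<subseteq> W" using \<pi>base[OF W] by blast
      have "\<not> V s \<subseteq> F" using interior_maximal[of "V s" F] V F(2) by auto
      then have "- F \<inter> V s \<noteq> {}" by blast
      then obtain i where "V (i # s) \<subseteq> - F"
        using Q(2)[OF V, of "- F" s "length s"] F(1) by (auto simp: V_simps)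
      then have "U (i # s) \<subseteq> H" by (auto simp: H_def)
      then show ?thesis using s U_sub[of i s] U(2)[of "i # s"] by blast
    qed
    then have "- closure H = {}" using closure_subset[of H] by (metis closed_closure disjoint_eq_subset_Compl open_Compl Compl_subset_Compl_iff)
    then have "closure H = UNIV" by blast
    moreover have "open H" using U(1) by (auto simp: H_def)
    moreover have "\<alpha> -` F - (\<Union>n. - G n) \<subseteq> - H" using \<alpha> by (fastforce simp: H_def)
    ultimately show ?thesis by (intro meager_in_subset[OF codense])
  qed
  have closed: "meager_in euclidean (\<alpha> -` F)" if "closed F" "interior F = {}" for F
    by (rule meager_in_subset[OF meager_in_Un[OF null rest[OF that]]]) blast
  show ?thesis
  proof (intro exI allI impI)
    fix M :: "'b set" assume "meager_in euclidean M"
    then obtain \<F> where F: "countable \<F>" "\<forall>F\<in>\<F>. closed F \<and> interior F = {}" "M \<subseteq> \<Union>\<F>"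
      unfolding meager_euclidean_iff by (elim exE conjE) (rule that)
    have "meager_in euclidean (\<Union>F\<in>\<F>. \<alpha> -` F)"
      using F(1,2) closed by (intro meager_in_Union) auto
    then show "meager_in euclidean (\<alpha> -` M)" by (rule meager_in_subset) (use F(3) in blast)
  qed
qed

section \<open>Cardinal invariants\<close>

text \<open>
  A function along which members of one family of sets pull back to members of another transports
  covers backwards and, by taking images, large sets forwards.
\<close>

lemma cov_le_of_vimage:
  fixes f :: "'a \<Rightarrow> 'b"
  assumes f: "\<And>A. A \<in> \<J> \<Longrightarrow> f -` A \<in> \<I>" and ex: "\<Union>\<J> = UNIV"
  shows "cov UNIV \<I> \<le>o cov UNIV \<J>"
proof -
  have "|\<J>| \<in> {|\<A>| | \<A>. \<A> \<subseteq> \<J> \<and> \<Union>\<A> = UNIV}"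
    by (intro CollectI exI[of _ \<J>] conjI refl order_refl ex)
  then have "{|\<A>| | \<A>. \<A> \<subseteq> \<J> \<and> \<Union>\<A> = UNIV} \<noteq> {}" by (metis empty_iff)
  then have "cov UNIV \<J> \<in> {|\<A>| | \<A>. \<A> \<subseteq> \<J> \<and> \<Union>\<A> = UNIV}"
    unfolding cov_def by (rule min_card(1)) (auto simp: card_of_Card_order)
  then obtain \<A> where A: "cov UNIV \<J> = |\<A>|" "\<A> \<subseteq> \<J>" "\<Union>\<A> = UNIV"
    unfolding mem_Collect_eq by (elim exE conjE) (rule that)
  have "\<Union>(vimage f ` \<A>) = f -` \<Union>\<A>" by blast
  then have "\<Union>(vimage f ` \<A>) = UNIV" using A(3) by simp
  moreover have "vimage f ` \<A> \<subseteq> \<I>" using f A(2) by blast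
  ultimately have mem: "|vimage f ` \<A>| \<in> {|\<B>| | \<B>. \<B> \<subseteq> \<I> \<and> \<Union>\<B> = UNIV}"
    by (intro CollectI exI[of _ "vimage f ` \<A>"] conjI refl)
  have "cov UNIV \<I> \<le>o |vimage f ` \<A>|"
    unfolding cov_def by (rule min_card(2)[OF _ _ mem]) (use mem in \<open>auto simp: card_of_Card_order\<close>)
  also have "|vimage f ` \<A>| \<le>o |\<A>|" by (rule card_of_image)
  finally show ?thesis unfolding A(1) .
qed

lemma non_le_of_vimage:
  fixes f :: "'a \<Rightarrow> 'b"
  assumes f: "\<And>A. A \<in> \<J> \<Longrightarrow> f -` A \<in> \<I>"
    and down: "\<And>A B. A \<in> \<I> \<Longrightarrow> B \<subseteq> A \<Longrightarrow> B \<in> \<I>" and proper: "UNIV \<notin> \<I>"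
  shows "non UNIV \<J> \<le>o non UNIV \<I>"
proof -
  have "|UNIV| \<in> {|H| | H. H \<subseteq> UNIV \<and> H \<notin> \<I>}"
    by (intro CollectI exI[of _ UNIV] conjI refl order_refl proper)
  then have "{|H| | H. H \<subseteq> UNIV \<and> H \<notin> \<I>} \<noteq> {}" by (metis empty_iff)
  then have "non UNIV \<I> \<in> {|H| | H. H \<subseteq> UNIV \<and> H \<notin> \<I>}"
    unfolding non_def by (rule min_card(1)) (auto simp: card_of_Card_order)
  then obtain H where H: "non UNIV \<I> = |H|" "H \<notin> \<I>"
    unfolding mem_Collect_eq by (elim exE conjE) (rule that)
  have "H \<subseteq> f -` f ` H" by blast
  then have "f -` f ` H \<notin> \<I>" using down H(2) by metis
  then have "f ` H \<notin> \<J>" using f by metis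
  then have mem: "|f ` H| \<in> {|H| | H. H \<subseteq> UNIV \<and> H \<notin> \<J>}"
    by (intro CollectI exI[of _ "f ` H"] conjI refl subset_UNIV)
  have "non UNIV \<J> \<le>o |f ` H|"
    unfolding non_def by (rule min_card(2)[OF _ _ mem]) (use mem in \<open>auto simp: card_of_Card_order\<close>)
  also have "|f ` H| \<le>o |H|" by (rule card_of_image)
  finally show ?thesis unfolding H(1) .
qed

lemma haar_meager_subset: "haar_meager X \<Longrightarrow> Y \<subseteq> X \<Longrightarrow> haar_meager Y"
  unfolding haar_meager_def by (meson order_trans)

lemma nondiscrete_group_perfect:
  fixes x :: "'a::topological_group_add"
  assumes "(euclidean :: 'a topology) \<noteq> discrete_topology UNIV"
  shows "\<not> open {x}"
proof
  assume x: "open {x}"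
  have "open {y}" for y :: 'a
    using open_translation_group[OF x, of "y - x"] by simp
  then have "open S" for S :: "'a set"
    using open_UN[of S "\<lambda>y. {y}"] by simp
  then have "(euclidean :: 'a topology) = discrete_topology UNIV"
    by (simp add: topology_eq)
  then show False using assms by contradiction
qed

theorem theorem2p6:
  fixes \<phi> :: "'g::{topological_group_add, polish_space} \<Rightarrow> 'h::{topological_group_add, polish_space}"
  assumes "continuous_on UNIV \<phi>"
    and "surj \<phi>"
    and "\<And>x y. \<phi> (x + y) = \<phi> x + \<phi> y"
    and "locally_compact_space (euclidean :: 'h topology)"
    and "(euclidean :: 'h topology) \<noteq> discrete_topology UNIV"
  shows "cov (UNIV :: 'g set) HM =o cov (UNIV :: real set) meager_reals \<and>
         non (UNIV :: 'g set) HM =o non (UNIV :: real set) meager_reals"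
proof -
  have "\<not> open {x}" for x :: real by (rule not_open_singleton)
  then obtain \<alpha> :: "real \<Rightarrow> 'g" where \<alpha>: "\<And>M. meager_in euclidean M \<Longrightarrow> meager_in euclidean (\<alpha> -` M)"
    using ex_meager_preserving_vimage[where 'a = real and 'b = 'g] by blast
  obtain \<gamma> :: "'h \<Rightarrow> real" where \<gamma>: "\<And>M. meager_in euclidean M \<Longrightarrow> meager_in euclidean (\<gamma> -` M)"
    using ex_meager_preserving_vimage[where 'a = 'h and 'b = real, OF nondiscrete_group_perfect[OF assms(5)]]
    by blast
  \<comment> \<open>The two functions \<open>\<alpha>\<close> and \<open>\<gamma> \<circ> \<phi>\<close> give the two inequalities for each invariant.\<close>
  have to_reals: "\<alpha> -` A \<in> meager_reals" if "A \<in> HM" for A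
    using \<alpha>[OF haar_meager_imp_meager] that by (simp add: HM_def meager_reals_def)
  have to_HM: "(\<gamma> \<circ> \<phi>) -` A \<in> HM" if A: "A \<in> meager_reals" for A
  proof -
    have "meager_in euclidean (\<gamma> -` A)" using A by (intro \<gamma>) (simp add: meager_reals_def)
    then have "haar_meager (\<phi> -` \<gamma> -` A)" by (rule haar_meager_vimage_meager[OF assms(1-4)])
    then show ?thesis by (simp add: HM_def vimage_comp)
  qed
  have "{x} \<in> meager_reals" for x :: real
    by (simp add: meager_reals_def meager_closed)
  then have "x \<in> \<Union>meager_reals" for x by (rule UnionI) simp
  then have cover_reals: "\<Union>meager_reals = UNIV" by blast
  have "x \<in> \<Union>(HM :: 'g set set)" for x
  proof -
    obtain A where "A \<in> meager_reals" "(\<gamma> \<circ> \<phi>) x \<in> A" using cover_reals by blast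
    then show ?thesis by (intro UnionI[OF to_HM]) auto
  qed
  then have cover_HM: "\<Union>(HM :: 'g set set) = UNIV" by blast
  have proper_reals: "UNIV \<notin> meager_reals"
    using open_meager_empty[of "UNIV :: real set"] by (auto simp: meager_reals_def)
  have proper_HM: "(UNIV :: 'g set) \<notin> HM"
    using to_reals[of UNIV] proper_reals by auto
  have down_reals: "B \<in> meager_reals" if "A \<in> meager_reals" "B \<subseteq> A" for A B
    using that meager_in_subset[of euclidean A B] by (simp add: meager_reals_def)
  have down_HM: "B \<in> HM" if "A \<in> HM" "B \<subseteq> A" for A B :: "'g set"
    using that haar_meager_subset[of A B] by (simp add: HM_def)
  show ?thesis
    unfolding ordIso_iff_ordLeq
    using cov_le_of_vimage[OF to_reals cover_HM] cov_le_of_vimage[OF to_HM cover_reals]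
      non_le_of_vimage[OF to_reals down_reals proper_reals] non_le_of_vimage[OF to_HM down_HM proper_HM]
    by simp
qed

end
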